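(* Let $G$ be a group and let $\Gamma$ be a connected, 2-edge-connected $G$-graph. Suppose that the cycle space $\mathcal{C}(\Gamma)$ is topologically $G$-finitely generated. Then $\mathcal{B}(\Gamma)$ is $G$-finitely generated, i.e. finitely generated as a $G$-module.
   Context: Graphs are simple and undirected, and are not assumed locally finite. A $G$-graph is a graph with an action of the group $G$ by automorphisms. For $b\subset V(\Gamma)$, $\delta b$ is the set of edges with exactly one endpoint in $b$. $\mathcal{B}(\Gamma)=\{b\subset V(\Gamma):|\delta b|<\infty\}$ is a Boolean ring (addition is symmetric difference, multiplication is intersection), on which $G$ acts; it is viewed as a $G$-module by forgetting multiplication. $\mathbb{Z}_2^{E(\Gamma)}=\prod_{E(\Gamma)}\mathbb{Z}_2$ carries the product topology, and the cycle space $\mathcal{C}(\Gamma)\le\mathbb{Z}_2^{E(\Gamma)}$ is the subgroup generated by (indicator functions of edge sets of) simple finite cycles. A subset $S\subset\mathcal{C}(\Gamma)$ is a topological generating set if $\mathcal{C}(\Gamma)\subset\overline{\langle S\rangle}$, the closure in $\mathbb{Z}_2^{E(\Gamma)}$ of the subgroup generated by $S$. $\mathcal{C}(\Gamma)$ is topologically $G$-finitely generated if there is a $G$-invariant topological generating set $S\subset\mathcal{C}(\Gamma)$ consisting of finitely many $G$-orbits. *)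

theory Defs
  imports
    "HOL-Algebra.Group_Action"
    "HOL-Algebra.Elementary_Groups"
    "HOL-Algebra.Product_Groups"
    "HOL-Algebra.Ring"
    "HOL-Analysis.Function_Topology"
begin

section \<open>Graphs with a group action\<close>

locale simple_graph =
  fixes V :: "'v set" and E :: "'v set set"
  assumes edges: "e \<in> E \<Longrightarrow> e \<subseteq> V \<and> card e = 2"

locale G_graph = group_action G V \<phi> + simple_graph V E
  for G :: "('g, 'm) monoid_scheme" (structure)
    and V :: "'v set" and E :: "'v set set" and \<phi> :: "'g \<Rightarrow> 'v \<Rightarrow> 'v" +
  assumes automorphism:
    "\<lbrakk>g \<in> carrier G; u \<in> V; v \<in> V\<rbrakk> \<Longrightarrow> {\<phi> g u, \<phi> g v} \<in> E \<longleftrightarrow> {u, v} \<in> E"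

definition graph_connected :: "'v set \<Rightarrow> 'v set set \<Rightarrow> bool" where
  "graph_connected V E \<longleftrightarrow> V \<noteq> {} \<and> (\<forall>u\<in>V. \<forall>v\<in>V. (u, v) \<in> {(x, y). {x, y} \<in> E}\<^sup>*)"

text \<open>The graph with a single vertex is allowed.\<close>

definition two_edge_connected :: "'v set \<Rightarrow> 'v set set \<Rightarrow> bool" where
  "two_edge_connected V E \<longleftrightarrow> graph_connected V E \<and> (\<forall>e\<in>E. graph_connected V (E - {e}))"


section \<open>Finitely generated modules over a group\<close>

text \<open>Here \<open>A\<close> is an abelian group in multiplicative notation, on which \<open>G\<close> acts through
  \<open>\<psi>\<close> by automorphisms.\<close>

definition G_submodule ::
  "('g, 'm) monoid_scheme \<Rightarrow> ('a, 'n) monoid_scheme \<Rightarrow> ('g \<Rightarrow> 'a \<Rightarrow> 'a) \<Rightarrow> 'a set \<Rightarrow> bool" where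
  "G_submodule G A \<psi> M \<longleftrightarrow> subgroup M A \<and> (\<forall>g\<in>carrier G. \<forall>x\<in>M. \<psi> g x \<in> M)"

definition G_submodule_generated ::
  "('g, 'm) monoid_scheme \<Rightarrow> ('a, 'n) monoid_scheme \<Rightarrow> ('g \<Rightarrow> 'a \<Rightarrow> 'a) \<Rightarrow> 'a set \<Rightarrow> 'a set" where
  "G_submodule_generated G A \<psi> F = \<Inter>{M. G_submodule G A \<psi> M \<and> F \<subseteq> M}"

definition G_finitely_generated ::
  "('g, 'm) monoid_scheme \<Rightarrow> ('a, 'n) monoid_scheme \<Rightarrow> ('g \<Rightarrow> 'a \<Rightarrow> 'a) \<Rightarrow> bool" where
  "G_finitely_generated G A \<psi> \<longleftrightarrow>
     (\<exists>F. finite F \<and> F \<subseteq> carrier A \<and> G_submodule_generated G A \<psi> F = carrier A)"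


section \<open>The Boolean ring of vertex sets with finite coboundary\<close>

definition coboundary :: "'v set set \<Rightarrow> 'v set \<Rightarrow> 'v set set" where
  "coboundary E b = {e \<in> E. card (e \<inter> b) = 1}"

definition Bool_ring :: "'v set \<Rightarrow> 'v set set \<Rightarrow> 'v set ring" where
  "Bool_ring V E =
     \<lparr>carrier = {b. b \<subseteq> V \<and> finite (coboundary E b)},
      monoid.mult = (\<inter>), one = V,
      zero = {}, add = (\<lambda>a b. (a - b) \<union> (b - a))\<rparr>"

definition vertex_set_action :: "('g \<Rightarrow> 'v \<Rightarrow> 'v) \<Rightarrow> 'g \<Rightarrow> 'v set \<Rightarrow> 'v set" where
  "vertex_set_action \<phi> g b = \<phi> g ` b"


section \<open>The cycle space\<close>

abbreviation Z2 :: "int monoid" where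
  "Z2 \<equiv> integer_mod_group 2"

definition edge_space :: "'v set set \<Rightarrow> ('v set \<Rightarrow> int) monoid" where
  "edge_space E = product_group E (\<lambda>_. Z2)"

definition edge_space_topology :: "'v set set \<Rightarrow> ('v set \<Rightarrow> int) topology" where
  "edge_space_topology E = product_topology (\<lambda>_. discrete_topology (carrier Z2)) E"

definition edge_indicator :: "'v set set \<Rightarrow> 'v set set \<Rightarrow> 'v set \<Rightarrow> int" where
  "edge_indicator E C = (\<lambda>e\<in>E. if e \<in> C then 1 else 0)"

text \<open>The list contains every vertex of the cycle once; its last entry is joined to the first.\<close>

definition closed_walk_edges :: "'v list \<Rightarrow> 'v set set" where
  "closed_walk_edges vs = {{vs ! i, vs ! (Suc i mod length vs)} | i. i < length vs}"

definition simple_cycles :: "'v set set \<Rightarrow> 'v set set set" where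
  "simple_cycles E =
     {closed_walk_edges vs | vs. 3 \<le> length vs \<and> distinct vs \<and> closed_walk_edges vs \<subseteq> E}"

definition cycle_space :: "'v set set \<Rightarrow> ('v set \<Rightarrow> int) set" where
  "cycle_space E = generate (edge_space E) (edge_indicator E ` simple_cycles E)"

text \<open>The action moves the coordinate at \<open>e\<close> to the coordinate at \<open>g \<cdot> e\<close>, so the indicator
  function of a set of edges is sent to that of its translate.\<close>

definition edge_space_action ::
  "('g, 'm) monoid_scheme \<Rightarrow> 'v set set \<Rightarrow> ('g \<Rightarrow> 'v \<Rightarrow> 'v) \<Rightarrow>
     'g \<Rightarrow> ('v set \<Rightarrow> int) \<Rightarrow> ('v set \<Rightarrow> int)" where
  "edge_space_action G E \<phi> g x = (\<lambda>e\<in>E. x (\<phi> (inv\<^bsub>G\<^esub> g) ` e))"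

definition topological_generating_set :: "'v set set \<Rightarrow> ('v set \<Rightarrow> int) set \<Rightarrow> bool" where
  "topological_generating_set E S \<longleftrightarrow>
     S \<subseteq> cycle_space E \<and>
     cycle_space E \<subseteq> edge_space_topology E closure_of generate (edge_space E) S"

definition topologically_G_finitely_generated ::
  "('g, 'm) monoid_scheme \<Rightarrow> 'v set set \<Rightarrow> ('g \<Rightarrow> 'v \<Rightarrow> 'v) \<Rightarrow> bool" where
  "topologically_G_finitely_generated G E \<phi> \<longleftrightarrow>
     (\<exists>S. topological_generating_set E S \<and>
          (\<forall>g\<in>carrier G. \<forall>x\<in>S. edge_space_action G E \<phi> g x \<in> S) \<and>
          finite (orbits G S (edge_space_action G E \<phi>)))"


section \<open>Well-definedness\<close>

lemma (in simple_graph) coboundary_alt: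
  assumes "e \<in> E"
  obtains u v where "e = {u, v}" "u \<noteq> v" "u \<in> V" "v \<in> V"
    "\<And>b. e \<in> coboundary E b \<longleftrightarrow> (u \<in> b) \<noteq> (v \<in> b)"
proof -
  obtain u v where uv: "e = {u, v}" "u \<noteq> v"
    using edges[OF assms] by (auto simp: card_2_iff)
  have "e \<in> coboundary E b \<longleftrightarrow> (u \<in> b) \<noteq> (v \<in> b)" for b
    using assms uv by (auto simp: coboundary_def Int_insert_left)
  with uv edges[OF assms] that show thesis by auto
qed

lemma (in simple_graph) Bool_ring_cring: "cring (Bool_ring V E)"
proof -
  have sd: "finite (coboundary E ((a - b) \<union> (b - a)))"
    if "finite (coboundary E a)" "finite (coboundary E b)" for a b
  proof (rule finite_subset)
    show "coboundary E ((a - b) \<union> (b - a)) \<subseteq> coboundary E a \<union> coboundary E b"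
    proof
      fix e assume e: "e \<in> coboundary E ((a - b) \<union> (b - a))"
      then have "e \<in> E" by (simp add: coboundary_def)
      from coboundary_alt[OF this] e show "e \<in> coboundary E a \<union> coboundary E b"
        by (metis DiffE DiffI UnCI UnE)
    qed
  qed (use that in simp)
  have int: "finite (coboundary E (a \<inter> b))"
    if "finite (coboundary E a)" "finite (coboundary E b)" for a b
  proof (rule finite_subset)
    show "coboundary E (a \<inter> b) \<subseteq> coboundary E a \<union> coboundary E b"
    proof
      fix e assume e: "e \<in> coboundary E (a \<inter> b)"
      then have "e \<in> E" by (simp add: coboundary_def)
      from coboundary_alt[OF this] e show "e \<in> coboundary E a \<union> coboundary E b"
        by (metis IntD1 IntD2 IntI UnCI)
    qed
  qed (use that in simp)
  have one: "coboundary E V = {}"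
  proof -
    have "e \<inter> V = e" "card e = 2" if "e \<in> E" for e using edges[OF that] by auto
    then show ?thesis by (auto simp: coboundary_def)
  qed
  have zero: "coboundary E {} = {}" by (auto simp: coboundary_def)
  show ?thesis
  proof (rule cringI)
    show "abelian_group (Bool_ring V E)"
    proof (rule abelian_groupI)
      fix x assume "x \<in> carrier (Bool_ring V E)"
      then show "\<exists>y\<in>carrier (Bool_ring V E). y \<oplus>\<^bsub>Bool_ring V E\<^esub> x = \<zero>\<^bsub>Bool_ring V E\<^esub>"
        by (intro bexI[of _ x]) (simp_all add: Bool_ring_def)
    qed (simp_all add: Bool_ring_def sd zero, blast+)
    show "comm_monoid (Bool_ring V E)"
      by (rule comm_monoidI) (auto simp: Bool_ring_def int one)
  qed (auto simp: Bool_ring_def)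
qed

lemma (in G_graph) edge_image_iff:
  assumes "g \<in> carrier G" "u \<in> V" "v \<in> V"
  shows "\<phi> g ` {u, v} \<in> E \<longleftrightarrow> {u, v} \<in> E"
  using automorphism[OF assms] by simp

lemma (in G_graph) vertex_set_action_closed:
  assumes g: "g \<in> carrier G" and b: "b \<in> carrier (Bool_ring V E)"
  shows "vertex_set_action \<phi> g b \<in> carrier (Bool_ring V E)"
proof -
  have bV: "b \<subseteq> V" and fin: "finite (coboundary E b)" using b by (auto simp: Bool_ring_def)
  have inj: "inj_on (\<phi> g) V" and img: "\<phi> g ` V = V" using inj_prop surj_prop g by auto
  have "coboundary E (\<phi> g ` b) \<subseteq> (`) (\<phi> g) ` coboundary E b"
  proof
    fix e assume e: "e \<in> coboundary E (\<phi> g ` b)"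
    then have eE: "e \<in> E" and c: "card (e \<inter> \<phi> g ` b) = 1" by (auto simp: coboundary_def)
    from coboundary_alt[OF eE] obtain u v where e_uv: "e = {u, v}" "u \<in> V" "v \<in> V" .
    from e_uv img obtain u' where u': "u' \<in> V" "u = \<phi> g u'" by blast
    from e_uv img obtain v' where v': "v' \<in> V" "v = \<phi> g v'" by blast
    from e_uv u' v' have uv: "u' \<in> V" "v' \<in> V" "e = \<phi> g ` {u', v'}" by simp_all
    have "{u', v'} \<in> E" using edge_image_iff[OF g uv(1,2)] eE uv(3) by simp
    moreover have "e \<inter> \<phi> g ` b = \<phi> g ` ({u', v'} \<inter> b)"
      unfolding uv(3) using inj_on_image_Int[OF inj, of "{u', v'}" b] uv(1,2) bV by simp
    then have "card ({u', v'} \<inter> b) = 1"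
      using c card_image[OF inj_on_subset[OF inj], of "{u', v'} \<inter> b"] uv(1,2) by (simp add: le_infI1)
    ultimately show "e \<in> (`) (\<phi> g) ` coboundary E b" unfolding uv(3) by (intro imageI) (simp add: coboundary_def)
  qed
  with fin have "finite (coboundary E (\<phi> g ` b))" by (meson finite_imageI finite_subset)
  then show ?thesis using bV img by (auto simp: Bool_ring_def vertex_set_action_def)
qed

lemma edge_indicator_closed: "edge_indicator E C \<in> carrier (edge_space E)"
  by (auto simp: edge_indicator_def edge_space_def carrier_integer_mod_group)

lemma topspace_edge_space: "topspace (edge_space_topology E) = carrier (edge_space E)"
  by (simp add: edge_space_topology_def edge_space_def)

end

theory Submission
  imports Defs
begin

text \<open>Call a cut essential if it is not a sum of cuts of smaller order. Essential cuts are minimal,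
  so only finitely many of a given order contain a given edge, and only finitely many of bounded
  order cross a given cut. Since the edges form finitely many orbits, the theorem amounts to the
  orders of essential cuts being bounded. By submodularity, two crossing essential cuts have an
  opposite pair of corners that are essential of the same two orders; so the essential cuts that
  minimise, within their order, the number of crossings form a nested family.

  A finite set of edges is a coboundary iff it meets the support of every topological generator
  of the cycle space in an even number of edges. If there were many orders, then, as the vertices
  of generators form finitely many orbits, comparing the parities below for all sets of orders
  (and taking the symmetric difference of two sets with equal parities) yields a
  nonempty set of orders such that, for all \<open>x, y, z\<close> on a common generator, evenly many cuts of these
  orders in the nested family separate \<open>x\<close> from \<open>y\<close> and \<open>z\<close>. Pairing consecutive cuts
  across each edge then gives two different nested cuts with the same coboundary.\<close>

section \<open>Coboundaries\<close>

context simple_graph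
begin

lemma edgeE:
  assumes "e \<in> E"
  obtains u v where "e = {u, v}" "u \<noteq> v" "u \<in> V" "v \<in> V"
  using coboundary_alt[OF assms] by metis

lemma edge_mem_coboundary:
  assumes "{u, v} \<in> E"
  shows "{u, v} \<in> coboundary E b \<longleftrightarrow> (u \<in> b) \<noteq> (v \<in> b)"
  using coboundary_alt[OF assms] by (metis doubleton_eq_iff)

lemma coboundaryE:
  assumes "e \<in> coboundary E b"
  obtains u v where "e = {u, v}" "{u, v} \<in> E" "u \<in> b" "v \<notin> b" "u \<in> V" "v \<in> V"
proof -
  have "e \<in> E" using assms by (simp add: coboundary_def)
  then obtain u v where uv: "e = {u, v}" "u \<noteq> v" "u \<in> V" "v \<in> V" by (rule edgeE)
  have "(u \<in> b) \<noteq> (v \<in> b)" using edge_mem_coboundary[of u v b] assms uv \<open>e \<in> E\<close> by simp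
  then show thesis using that[of u v] that[of v u] uv \<open>e \<in> E\<close> by (auto simp: insert_commute)
qed

lemma coboundary_subset: "coboundary E b \<subseteq> E"
  by (auto simp: coboundary_def)

lemma coboundary_eqI:
  assumes "F \<subseteq> E" and "\<And>u v. {u, v} \<in> E \<Longrightarrow> {u, v} \<in> F \<longleftrightarrow> (u \<in> b) \<noteq> (v \<in> b)"
  shows "coboundary E b = F"
proof (unfold set_eq_iff, rule allI)
  fix e
  show "e \<in> coboundary E b \<longleftrightarrow> e \<in> F"
  proof (cases "e \<in> E")
    case True
    then obtain u v where "e = {u, v}" by (rule edgeE)
    then show ?thesis using True assms(2) edge_mem_coboundary by simp
  qed (use assms(1) coboundary_subset in blast)
qed

lemma coboundary_sym_diff:
  "coboundary E (sym_diff a b) = sym_diff (coboundary E a) (coboundary E b)"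
  by (rule coboundary_eqI) (use coboundary_subset in \<open>auto simp: edge_mem_coboundary\<close>)

lemma coboundary_empty [simp]: "coboundary E {} = {}"
  by (auto simp: coboundary_def)

lemma edge_subset: "{u, v} \<in> E \<Longrightarrow> u \<in> V \<and> v \<in> V"
  using edges by blast

lemma coboundary_compl: "coboundary E (V - b) = coboundary E b"
  by (rule coboundary_eqI) (use coboundary_subset edge_subset in \<open>auto simp: edge_mem_coboundary\<close>)

lemma coboundary_V [simp]: "coboundary E V = {}"
  using coboundary_compl[of "{}"] by simp

lemma card_coboundary_Int_Un:
  assumes "finite (coboundary E a)" "finite (coboundary E b)"
  shows "finite (coboundary E (a \<inter> b))" "finite (coboundary E (a \<union> b))"
    "card (coboundary E (a \<inter> b)) + card (coboundary E (a \<union> b)) \<le>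
     card (coboundary E a) + card (coboundary E b)"
proof -
  let ?d = "coboundary E"
  have un: "?d (a \<inter> b) \<union> ?d (a \<union> b) \<subseteq> ?d a \<union> ?d b"
  proof
    fix e assume e: "e \<in> ?d (a \<inter> b) \<union> ?d (a \<union> b)"
    then have "e \<in> E" using coboundary_subset by blast
    then obtain u v where "e = {u, v}" by (rule edgeE)
    then show "e \<in> ?d a \<union> ?d b" using e \<open>e \<in> E\<close> by (auto simp: edge_mem_coboundary)
  qed
  have int: "?d (a \<inter> b) \<inter> ?d (a \<union> b) \<subseteq> ?d a \<inter> ?d b"
  proof
    fix e assume e: "e \<in> ?d (a \<inter> b) \<inter> ?d (a \<union> b)"
    then have "e \<in> E" using coboundary_subset by blast
    then obtain u v where "e = {u, v}" by (rule edgeE)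
    then show "e \<in> ?d a \<inter> ?d b" using e \<open>e \<in> E\<close> by (auto simp: edge_mem_coboundary)
  qed
  show fin: "finite (?d (a \<inter> b))" "finite (?d (a \<union> b))"
    using un assms by (meson finite_UnI finite_subset le_sup_iff)+
  have "card (?d (a \<inter> b)) + card (?d (a \<union> b)) =
        card (?d (a \<inter> b) \<union> ?d (a \<union> b)) + card (?d (a \<inter> b) \<inter> ?d (a \<union> b))"
    using card_Un_Int fin by blast
  also have "\<dots> \<le> card (?d a \<union> ?d b) + card (?d a \<inter> ?d b)"
    using un int assms by (intro add_mono card_mono) auto
  also have "\<dots> = card (?d a) + card (?d b)" using card_Un_Int assms by metis
  finally show "card (?d (a \<inter> b)) + card (?d (a \<union> b)) \<le> card (?d a) + card (?d b)" .
qed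

text \<open>A finite set of edges stands for a path from \<open>u\<close> to \<open>v\<close>: all that matters about the path
  is that it meets every coboundary separating its ends.\<close>

lemma finite_edges_meet_separating_coboundaries:
  assumes "(u, v) \<in> {(x, y). {x, y} \<in> E'}\<^sup>*" and "E' \<subseteq> E"
  obtains P where "finite P" "P \<subseteq> E'"
    "\<And>d. (u \<in> d) \<noteq> (v \<in> d) \<Longrightarrow> P \<inter> coboundary E d \<noteq> {}"
proof -
  from assms(1) have "\<exists>P. finite P \<and> P \<subseteq> E' \<and>
      (\<forall>d. (u \<in> d) \<noteq> (v \<in> d) \<longrightarrow> P \<inter> coboundary E d \<noteq> {})"
  proof (induction rule: rtrancl_induct)
    case base
    show ?case by auto
  next
    case (step y z)
    then obtain P where P: "finite P" "P \<subseteq> E'"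
      "\<forall>d. (u \<in> d) \<noteq> (y \<in> d) \<longrightarrow> P \<inter> coboundary E d \<noteq> {}" by blast
    have yz: "{y, z} \<in> E'" using step by simp
    have "insert {y, z} P \<inter> coboundary E d \<noteq> {}" if "(u \<in> d) \<noteq> (z \<in> d)" for d
    proof (cases "(u \<in> d) \<noteq> (y \<in> d)")
      case True
      then show ?thesis using P(3) by auto
    next
      case False
      then have "{y, z} \<in> coboundary E d"
        using that edge_mem_coboundary[of y z d] yz assms(2) by auto
      then show ?thesis by simp
    qed
    with P yz show ?case by (intro exI[of _ "insert {y, z} P"]) auto
  qed
  then show thesis using that by blast
qed

lemma coboundary_empty_connected:
  assumes "graph_connected V E'" "E' \<subseteq> E" "b \<subseteq> V" "coboundary E b \<inter> E' = {}"
  shows "b = {} \<or> b = V"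
proof (rule ccontr)
  assume "\<not> ?thesis"
  then obtain u v where uv: "u \<in> b" "v \<in> V" "v \<notin> b" "u \<in> V" using assms(3) by blast
  then have "(u, v) \<in> {(x, y). {x, y} \<in> E'}\<^sup>*" using assms(1) by (auto simp: graph_connected_def)
  from finite_edges_meet_separating_coboundaries[OF this assms(2)]
  obtain P where P: "P \<subseteq> E'" "\<And>d. (u \<in> d) \<noteq> (v \<in> d) \<Longrightarrow> P \<inter> coboundary E d \<noteq> {}" by metis
  have "P \<inter> coboundary E b \<noteq> {}" using P(2) uv by blast
  then show False using assms(4) P(1) by blast
qed

end


section \<open>Cycles and coboundaries\<close>

fun walk_count :: "'v set set \<Rightarrow> 'v list \<Rightarrow> nat" where
  "walk_count F (x # y # zs) = of_bool ({x, y} \<in> F) + walk_count F (y # zs)"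
| "walk_count F _ = 0"

lemma walk_count_append:
  "walk_count F (xs @ y # ys) = walk_count F (xs @ [y]) + walk_count F (y # ys)"
  by (induction F xs rule: walk_count.induct) (cases xs; simp)+

lemma walk_count_eq_sum:
  "walk_count F vs = (\<Sum>i<length vs - 1. of_bool ({vs ! i, vs ! Suc i} \<in> F))"
proof (induction F vs rule: walk_count.induct)
  case (1 F x y zs)
  then show ?case
    by (simp add: sum.lessThan_Suc_shift del: sum.lessThan_Suc sum_of_bool_eq)
qed auto

lemma closed_walk_edges_eq_image:
  "closed_walk_edges vs = (\<lambda>i. {vs ! i, vs ! (Suc i mod length vs)}) ` {..<length vs}"
  by (auto simp: closed_walk_edges_def)

lemma inj_on_closed_walk_edge:
  assumes "3 \<le> length vs" "distinct vs"
  shows "inj_on (\<lambda>i. {vs ! i, vs ! (Suc i mod length vs)}) {..<length vs}"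
proof (rule inj_onI)
  fix i j assume ij: "i \<in> {..<length vs}" "j \<in> {..<length vs}"
    and eq: "{vs ! i, vs ! (Suc i mod length vs)} = {vs ! j, vs ! (Suc j mod length vs)}"
  have lt: "Suc i mod length vs < length vs" "Suc j mod length vs < length vs"
    using assms(1) by (auto intro: mod_less_divisor)
  from eq have "i = j \<or> (i = Suc j mod length vs \<and> Suc i mod length vs = j)"
    using nth_eq_iff_index_eq[OF assms(2)] ij lt by (auto simp: doubleton_eq_iff)
  then show "i = j"
  proof
    assume *: "i = Suc j mod length vs \<and> Suc i mod length vs = j"
    show "i = j"
      using * ij assms(1) by (cases "Suc i = length vs"; cases "Suc j = length vs") auto
  qed
qed

lemma walk_count_simple_cycle:
  assumes "3 \<le> length vs" "distinct vs"
  shows "walk_count F (last vs # vs) = card (F \<inter> closed_walk_edges vs)"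
proof -
  let ?f = "\<lambda>i. {vs ! i, vs ! (Suc i mod length vs)}"
  obtain n where n: "length vs = Suc n" using assms(1) by (cases "length vs") auto
  have "F \<inter> closed_walk_edges vs = ?f ` {i. i < length vs \<and> ?f i \<in> F}"
    unfolding closed_walk_edges_eq_image by auto
  moreover have "inj_on ?f {i. i < length vs \<and> ?f i \<in> F}"
    using inj_on_closed_walk_edge[OF assms] by (rule inj_on_subset) auto
  ultimately have "card (F \<inter> closed_walk_edges vs) = card {i. i < length vs \<and> ?f i \<in> F}"
    by (simp add: card_image)
  also have "\<dots> = (\<Sum>i<length vs. of_bool (?f i \<in> F))"
    by (simp add: Int_def flip: lessThan_iff)
  also have "\<dots> = (\<Sum>i<n. of_bool ({vs ! i, vs ! Suc i} \<in> F)) + of_bool ({vs ! n, vs ! 0} \<in> F)"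
    by (simp add: n)
  also have "\<dots> = walk_count F (last vs # vs)"
  proof -
    obtain w ws where "vs = w # ws" using n by (cases vs) auto
    then show ?thesis using n walk_count_eq_sum[of F vs] last_conv_nth[of vs] by simp
  qed
  finally show ?thesis by simp
qed

context simple_graph
begin

lemma walk_count_coboundary:
  assumes "vs \<noteq> []" "successively (\<lambda>x y. {x, y} \<in> E) vs"
  shows "odd (walk_count (coboundary E b) vs) \<longleftrightarrow> (hd vs \<in> b) \<noteq> (last vs \<in> b)"
  using assms
proof (induction "coboundary E b" vs rule: walk_count.induct)
  case (1 x y zs)
  then show ?case using edge_mem_coboundary[of x y b] by auto
qed auto

lemma simple_cycle_walk:
  assumes "closed_walk_edges vs \<subseteq> E" "vs \<noteq> []"
  shows "successively (\<lambda>x y. {x, y} \<in> E) (last vs # vs)"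
proof -
  have "{vs ! i, vs ! (Suc i mod length vs)} \<in> E" if "i < length vs" for i
    using assms(1) that by (auto simp: closed_walk_edges_eq_image)
  from this[of "length vs - 1"] this have
    "{last vs, hd vs} \<in> E" "\<And>i. Suc i < length vs \<Longrightarrow> {vs ! i, vs ! Suc i} \<in> E"
    using assms(2) by (auto simp: last_conv_nth hd_conv_nth) (metis Suc_lessD mod_less)
  then have "successively (\<lambda>x y. {x, y} \<in> E) vs" "{last vs, hd vs} \<in> E"
    by (auto simp: successively_conv_nth)
  then show ?thesis
    using assms(2) by (simp add: successively_Cons)
qed

lemma even_card_coboundary_simple_cycle:
  assumes "C \<in> simple_cycles E"
  shows "even (card (coboundary E b \<inter> C))"
proof -
  obtain vs where vs: "C = closed_walk_edges vs" "3 \<le> length vs" "distinct vs"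
      "closed_walk_edges vs \<subseteq> E"
    using assms by (auto simp: simple_cycles_def)
  then have "vs \<noteq> []" by auto
  with walk_count_coboundary[OF _ simple_cycle_walk[OF vs(4)], of b]
  show ?thesis using walk_count_simple_cycle[OF vs(2,3)] vs(1) by simp
qed

lemma even_closed_walk_count:
  assumes F: "\<And>C. C \<in> simple_cycles E \<Longrightarrow> even (card (F \<inter> C))"
  shows "successively (\<lambda>x y. {x, y} \<in> E) (last vs # vs) \<Longrightarrow> even (walk_count F (last vs # vs))"
proof (induction "length vs" arbitrary: vs rule: less_induct)
  case less
  show ?case
  proof (cases "distinct vs")
    case dist: True
    consider "vs = []" | x where "vs = [x]" | x y where "vs = [x, y]" | "3 \<le> length vs"
    proof -
      have "vs = [] \<or> (\<exists>x. vs = [x]) \<or> (\<exists>x y. vs = [x, y]) \<or> 3 \<le> length vs"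
        by (cases vs; cases "tl vs"; cases "tl (tl vs)") auto
      then show thesis using that by blast
    qed
    then show ?thesis
    proof cases
      case 2
      then have "{x} \<in> E" using less.prems by simp
      then show ?thesis using edges[of "{x}"] by simp
    next
      case 3
      then show ?thesis by (simp add: insert_commute)
    next
      case 4
      have "closed_walk_edges vs \<subseteq> E"
      proof (clarsimp simp: closed_walk_edges_eq_image)
        fix i assume i: "i < length vs"
        have s: "successively (\<lambda>x y. {x, y} \<in> E) vs" "{last vs, hd vs} \<in> E"
          using less.prems 4 by (auto simp: successively_Cons)
        show "{vs ! i, vs ! (Suc i mod length vs)} \<in> E"
        proof (cases "Suc i = length vs")
          case True
          then have "i = length vs - 1" "vs \<noteq> []" by auto
          then show ?thesis using s(2) by (simp add: last_conv_nth hd_conv_nth)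
        next
          case False
          then show ?thesis using s(1) i by (simp add: successively_conv_nth)
        qed
      qed
      then show ?thesis
        using F[of "closed_walk_edges vs"] 4 dist walk_count_simple_cycle[OF 4 dist, of F]
        by (auto simp: simple_cycles_def)
    qed simp
  next
    case False
    then obtain xs ys zs y where vs: "vs = xs @ [y] @ ys @ [y] @ zs"
      using not_distinct_decomp by blast
    define l where "l = last vs"
    let ?p = "ys @ [y]" and ?q = "xs @ [y] @ zs"
    have q: "last ?q = l" by (simp add: l_def vs)
    have "walk_count F (l # vs) = walk_count F ((l # xs) @ [y]) + walk_count F ((y # ys) @ y # zs)"
      using walk_count_append[of F "l # xs" y "ys @ y # zs"] by (simp add: vs)
    also have "\<dots> = walk_count F ((l # xs) @ [y]) + walk_count F (y # zs) + walk_count F (y # ?p)"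
      using walk_count_append[of F "y # ys" y zs] by simp
    also have "walk_count F ((l # xs) @ [y]) + walk_count F (y # zs) = walk_count F (l # ?q)"
      using walk_count_append[of F "l # xs" y zs] by simp
    finally have eq: "walk_count F (l # vs) =
        walk_count F (last ?q # ?q) + walk_count F (last ?p # ?p)"
      unfolding q by simp
    let ?walk = "successively (\<lambda>x y. {x, y} \<in> E)"
    have split: "?walk (ws @ y # ws') \<longleftrightarrow> ?walk (ws @ [y]) \<and> ?walk (y # ws')" for ws ws'
      by (auto simp: successively_append_iff)
    have "?walk ((l # xs) @ y # ys @ y # zs)"
      using less.prems by (simp add: l_def vs)
    from iffD1[OF split this] have w: "?walk ((l # xs) @ [y])" "?walk ((y # ys) @ y # zs)"
      by simp_all
    from iffD1[OF split w(2)] have w': "?walk ((y # ys) @ [y])" "?walk (y # zs)"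
      by simp_all
    have "?walk ((l # xs) @ y # zs)" by (rule iffD2[OF split conjI[OF w(1) w'(2)]])
    then have "even (walk_count F (last ?q # ?q))"
      by (intro less.hyps) (simp_all add: vs q[simplified])
    moreover have "even (walk_count F (last ?p # ?p))"
      using w'(1) by (intro less.hyps) (simp_all add: vs)
    ultimately show ?thesis unfolding eq[unfolded l_def] by simp
  qed
qed

lemma coboundary_if_even_on_simple_cycles:
  assumes conn: "graph_connected V E" and "F \<subseteq> E"
    and F: "\<And>C. C \<in> simple_cycles E \<Longrightarrow> even (card (F \<inter> C))"
  obtains b where "b \<subseteq> V" "coboundary E b = F"
proof -
  let ?walk = "successively (\<lambda>x y. {x, y} \<in> E)"
  obtain o' where o': "o' \<in> V" using conn by (auto simp: graph_connected_def)
  have ex: "\<exists>vs. ?walk (o' # vs) \<and> last (o' # vs) = v" if "v \<in> V" for v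
  proof -
    have "(o', v) \<in> {(x, y). {x, y} \<in> E}\<^sup>*" using conn o' that by (auto simp: graph_connected_def)
    then show ?thesis
    proof (induction rule: rtrancl_induct)
      case base
      show ?case by (intro exI[of _ "[]"]) simp
    next
      case (step y z)
      then obtain vs where "?walk (o' # vs)" "last (o' # vs) = y" by blast
      with step show ?case
        by (intro exI[of _ "vs @ [z]"])
           (auto simp: successively_append_iff successively_Cons split: if_splits)
    qed
  qed
  have rev_count: "walk_count F (rev vs) = walk_count F vs" for vs
  proof (induction F vs rule: walk_count.induct)
    case (1 F x y zs)
    then show ?case using walk_count_append[of F "rev zs" y "[x]"] by (simp add: insert_commute)
  qed auto
  have walk_rev: "?walk (rev vs) = ?walk vs" for vs
    by (simp add: successively_rev insert_commute)
  have indep: "even (walk_count F (o' # vs)) \<longleftrightarrow> even (walk_count F (o' # ws))"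
    if w: "?walk (o' # vs)" "?walk (o' # ws)" "last (o' # vs) = last (o' # ws)" for vs ws
  proof (cases "ws = []")
    case True
    then have "last (o' # vs) = o'" using w(3) by simp
    then show ?thesis using True even_closed_walk_count[OF F, of vs] w(1) by (cases "vs = []") auto
  next
    case False
    define us where "us = vs @ tl (rev ws) @ [o']"
    have l: "last us = o'" by (simp add: us_def)
    have rw: "rev (o' # ws) = last ws # tl (rev ws) @ [o']"
      using False by (cases ws rule: rev_cases) auto
    have "o' # us = butlast (o' # vs) @ rev (o' # ws)"
      using w(3) False rw append_butlast_last_id[of "o' # vs"]
      unfolding us_def by (metis append_Cons append_Nil append_assoc last_ConsR list.distinct(1))
    have split: "o' # us = butlast (o' # vs) @ last ws # (tl (rev ws) @ [o'])"
      using \<open>o' # us = _\<close> rw by simp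
    have vs: "butlast (o' # vs) @ [last ws] = o' # vs"
      using w(3) False append_butlast_last_id[of "o' # vs"] by simp
    have "?walk (o' # us)"
    proof -
      have "?walk (butlast (o' # vs) @ [last ws])" unfolding vs by (rule w(1))
      moreover have "?walk (last ws # (tl (rev ws) @ [o']))"
        using w(2) walk_rev[of "o' # ws"] unfolding rw by simp
      ultimately show ?thesis unfolding split by (auto simp: successively_append_iff)
    qed
    then have "even (walk_count F (o' # us))" using even_closed_walk_count[OF F, of us] l by simp
    moreover have "walk_count F (o' # us) = walk_count F (o' # vs) + walk_count F (o' # ws)"
      using walk_count_append[of F "butlast (o' # vs)" "last ws" "tl (rev ws) @ [o']"]
        rev_count[of "o' # ws"] unfolding split vs rw by simp
    ultimately show ?thesis by simp
  qed
  define b where "b = {v \<in> V. \<exists>vs. ?walk (o' # vs) \<and> last (o' # vs) = v \<and> odd (walk_count F (o' # vs))}"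
  have b: "last (o' # vs) \<in> b \<longleftrightarrow> odd (walk_count F (o' # vs))"
    if "?walk (o' # vs)" "last (o' # vs) \<in> V" for vs
    using that indep unfolding b_def by blast
  have "coboundary E b = F"
  proof (rule coboundary_eqI[OF assms(2)])
    fix u v assume uv: "{u, v} \<in> E"
    then have V: "u \<in> V" "v \<in> V" using edge_subset by auto
    obtain vs where vs: "?walk (o' # vs)" "last (o' # vs) = u" using ex V by blast
    have w: "?walk (o' # vs @ [v])"
      using vs uv by (auto simp: successively_append_iff successively_Cons split: if_splits)
    have "butlast (o' # vs) @ [u] = o' # vs" using append_butlast_last_id[of "o' # vs"] vs(2) by simp
    then have "walk_count F (o' # vs @ [v]) = walk_count F (o' # vs) + of_bool ({u, v} \<in> F)"
      using walk_count_append[of F "butlast (o' # vs)" u "[v]"]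
      by (metis append_Cons append_Nil append_assoc walk_count.simps(1,3) add.right_neutral)
    then show "{u, v} \<in> F \<longleftrightarrow> (u \<in> b) \<noteq> (v \<in> b)"
      using b[OF vs(1)] b[OF w] vs(2) V by auto
  qed
  then show thesis using that[of b] by (auto simp: b_def)
qed

end

section \<open>Essential cuts\<close>

locale connected_graph = simple_graph +
  assumes connected: "graph_connected V E"
begin

abbreviation \<delta> :: "'a set \<Rightarrow> 'a set set" where
  "\<delta> \<equiv> coboundary E"

abbreviation cut_order :: "'a set \<Rightarrow> nat" where
  "cut_order b \<equiv> card (\<delta> b)"

definition cuts :: "'a set set" where
  "cuts = {b. b \<subseteq> V \<and> finite (\<delta> b)}"

inductive_set lower_span :: "nat \<Rightarrow> 'a set set" for n where
  empty: "{} \<in> lower_span n"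
| add: "\<lbrakk>b \<in> cuts; cut_order b < n; c \<in> lower_span n\<rbrakk> \<Longrightarrow> sym_diff b c \<in> lower_span n"

definition essential :: "'a set set" where
  "essential = {b \<in> cuts. \<delta> b \<noteq> {} \<and> b \<notin> lower_span (cut_order b)}"

lemma cuts_sym_diff: "a \<in> cuts \<Longrightarrow> b \<in> cuts \<Longrightarrow> sym_diff a b \<in> cuts"
  by (auto simp: cuts_def coboundary_sym_diff)

lemma cuts_compl: "a \<in> cuts \<Longrightarrow> V - a \<in> cuts"
  by (auto simp: cuts_def coboundary_compl)

lemma cuts_empty [simp]: "{} \<in> cuts"
  by (auto simp: cuts_def)

lemma lower_span_sym_diff:
  "b \<in> lower_span n \<Longrightarrow> c \<in> lower_span n \<Longrightarrow> sym_diff b c \<in> lower_span n"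
proof (induction rule: lower_span.induct)
  case (add b b')
  have "sym_diff (sym_diff b b') c = sym_diff b (sym_diff b' c)" by blast
  then show ?case using lower_span.add[OF add.hyps(1,2)] add by metis
qed simp

lemma lower_span_mono: "b \<in> lower_span m \<Longrightarrow> m \<le> n \<Longrightarrow> b \<in> lower_span n"
  by (induction rule: lower_span.induct) (auto intro: lower_span.intros)

lemma lower_spanI: "b \<in> cuts \<Longrightarrow> cut_order b < n \<Longrightarrow> b \<in> lower_span n"
  using lower_span.add[OF _ _ lower_span.empty] by simp

lemma lower_span_compl:
  assumes "b \<in> lower_span n" "b \<subseteq> V" "0 < n"
  shows "V - b \<in> lower_span n"
proof -
  have "V \<in> lower_span n" using assms(3) by (intro lower_spanI) (auto simp: cuts_def)
  then have "sym_diff V b \<in> lower_span n" using assms(1) lower_span_sym_diff by blast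
  moreover have "sym_diff V b = V - b" using assms(2) by blast
  ultimately show ?thesis by simp
qed

lemma essentialD:
  assumes "a \<in> essential"
  shows "a \<subseteq> V" "a \<in> cuts" "finite (\<delta> a)" "0 < cut_order a" "a \<notin> lower_span (cut_order a)"
  using assms by (auto simp: essential_def cuts_def card_gt_0_iff)

lemma essentialI:
  assumes "b \<in> cuts" "0 < cut_order b" "b \<notin> lower_span (cut_order b)"
  shows "b \<in> essential"
  using assms by (auto simp: essential_def)

lemma essential_compl:
  assumes "a \<in> essential"
  shows "V - a \<in> essential"
proof (rule essentialI)
  show "V - a \<notin> lower_span (cut_order (V - a))"
    using lower_span_compl[of "V - a" "cut_order a"] essentialD[OF assms]
    by (auto simp: coboundary_compl double_diff)
qed (use essentialD[OF assms] in \<open>auto simp: cuts_compl coboundary_compl\<close>)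

lemma essential_minimal:
  assumes "a \<in> essential" "b \<subseteq> V" "\<delta> b \<subseteq> \<delta> a" "\<delta> b \<noteq> {}"
  shows "\<delta> b = \<delta> a"
proof (rule ccontr)
  assume ne: "\<delta> b \<noteq> \<delta> a"
  note a = essentialD[OF assms(1)]
  have fin: "finite (\<delta> b)" using assms(3) a(3) finite_subset by blast
  have b: "b \<in> cuts" using assms(2) fin by (simp add: cuts_def)
  have "cut_order b < cut_order a" using assms(3) ne a(3) by (intro psubset_card_mono) auto
  then have b_low: "b \<in> lower_span (cut_order a)" using b lower_spanI by blast
  have "\<delta> (sym_diff a b) = \<delta> a - \<delta> b" using assms(3) coboundary_sym_diff by auto
  then have "cut_order (sym_diff a b) < cut_order a"
    using assms(3,4) a(3) by (auto intro!: psubset_card_mono)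
  then have "sym_diff a b \<in> lower_span (cut_order a)"
    using cuts_sym_diff a(2) b lower_spanI by blast
  then have "sym_diff (sym_diff a b) b \<in> lower_span (cut_order a)"
    using b_low lower_span_sym_diff by blast
  moreover have "sym_diff (sym_diff a b) b = a" by blast
  ultimately show False using a(5) by simp
qed

lemma coboundary_eq_empty_iff: "b \<subseteq> V \<Longrightarrow> \<delta> b = {} \<longleftrightarrow> b = {} \<or> b = V"
  using coboundary_empty_connected[OF connected order.refl, of b] by auto

lemma coboundary_eqD:
  assumes "a \<subseteq> V" "b \<subseteq> V" "\<delta> a = \<delta> b"
  shows "a = b \<or> a = V - b"
proof -
  have "sym_diff a b = {} \<or> sym_diff a b = V"
    using assms coboundary_eq_empty_iff[of "sym_diff a b"] coboundary_sym_diff[of a b] by auto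
  then show ?thesis using assms(1,2) by blast
qed

lemma finite_essential_coboundaries_containing:
  assumes "finite D" "D \<noteq> {}" "D \<subseteq> E"
  shows "finite {F \<in> \<delta> ` essential. card F \<le> n \<and> D \<subseteq> F}"
  using assms
proof (induction "n - card D" arbitrary: D rule: less_induct)
  case less
  let ?X = "\<lambda>D. {F \<in> \<delta> ` essential. card F \<le> n \<and> D \<subseteq> F}"
  show ?case
  proof (cases "\<exists>F\<in>?X D. D \<noteq> F")
    case False
    then have "?X D \<subseteq> {D}" by auto
    then show ?thesis by (rule finite_subset) simp
  next
    case True
    then obtain a where a: "a \<in> essential" "D \<subset> \<delta> a" "cut_order a \<le> n" by blast
    have card: "card D < n"
      using a essentialD(3)[OF a(1)] psubset_card_mono by (meson less_le_trans)
    obtain e where e: "e \<in> D" using less.prems by blast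
    obtain u v where uv: "e = {u, v}" "{u, v} \<in> E" "u \<in> V" "v \<in> V" "u \<in> a" "v \<notin> a"
      using coboundaryE[of e a] a(2) e by blast
    \<comment> \<open>otherwise the component of \<open>u\<close> in \<open>E - D\<close> has its coboundary properly inside that of \<open>a\<close>\<close>
    have "(u, v) \<in> {(x, y). {x, y} \<in> E - D}\<^sup>*"
    proof (rule ccontr)
      assume nc: "\<not> ?thesis"
      define c where "c = {x \<in> V. (u, x) \<in> {(x, y). {x, y} \<in> E - D}\<^sup>*}"
      have "\<delta> c \<subseteq> D"
      proof
        fix f assume "f \<in> \<delta> c"
        then obtain x y where xy: "f = {x, y}" "{x, y} \<in> E" "x \<in> c" "y \<notin> c" "y \<in> V"
          by (rule coboundaryE)
        show "f \<in> D"
        proof (rule ccontr)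
          assume "f \<notin> D"
          then have "(x, y) \<in> {(x, y). {x, y} \<in> E - D}" using xy by simp
          then have "y \<in> c" using xy unfolding c_def by (auto intro: rtrancl_into_rtrancl)
          then show False using xy by simp
        qed
      qed
      moreover have "e \<in> \<delta> c"
        using uv nc edge_mem_coboundary[of u v c] by (auto simp: c_def)
      ultimately show False
        using essential_minimal[OF a(1), of c] a(2) by (auto simp: c_def)
    qed
    from finite_edges_meet_separating_coboundaries[OF this]
    obtain P where P: "finite P" "P \<subseteq> E - D"
      "\<And>d. (u \<in> d) \<noteq> (v \<in> d) \<Longrightarrow> P \<inter> \<delta> d \<noteq> {}" by (metis Diff_subset)
    have "?X D \<subseteq> (\<Union>f\<in>P. ?X (insert f D))"
    proof
      fix F assume F: "F \<in> ?X D"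
      then obtain d where d: "d \<in> essential" "F = \<delta> d" by blast
      have "{u, v} \<in> \<delta> d" using F d e uv by blast
      then have "(u \<in> d) \<noteq> (v \<in> d)" using edge_mem_coboundary uv(2) by blast
      then obtain f where "f \<in> P" "f \<in> \<delta> d" using P(3)[of d] by blast
      then show "F \<in> (\<Union>f\<in>P. ?X (insert f D))" using F d by auto
    qed
    moreover have "finite (?X (insert f D))" if "f \<in> P" for f
    proof (rule less.hyps)
      show "n - card (insert f D) < n - card D"
        using that P(2) less.prems(1) card by (auto simp: card_insert_if)
    qed (use that P(2) less.prems in auto)
    ultimately show ?thesis using P(1) by (meson finite_UN_I finite_subset)
  qed
qed

lemma finite_essential_through_edge:
  assumes "e \<in> E"
  shows "finite {a \<in> essential. cut_order a \<le> n \<and> e \<in> \<delta> a}"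
proof -
  let ?A = "{a \<in> essential. cut_order a \<le> n \<and> e \<in> \<delta> a}"
  obtain u where u: "u \<in> V" using assms by (metis edgeE)
  have "inj_on (\<lambda>a. (\<delta> a, u \<in> a)) ?A"
    using coboundary_eqD essentialD(1) u by (intro inj_onI) blast
  moreover have "(\<lambda>a. (\<delta> a, u \<in> a)) ` ?A \<subseteq> {F \<in> \<delta> ` essential. card F \<le> n \<and> {e} \<subseteq> F} \<times> UNIV"
    by auto
  moreover have "finite {F \<in> \<delta> ` essential. card F \<le> n \<and> {e} \<subseteq> F}"
    using assms by (intro finite_essential_coboundaries_containing) auto
  ultimately show ?thesis by (meson finite_SigmaI finite_UNIV finite_imageD finite_subset)
qed


section \<open>Crossing cuts\<close>

definition crosses :: "'a set \<Rightarrow> 'a set \<Rightarrow> bool" where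
  "crosses a b \<longleftrightarrow> a \<inter> b \<noteq> {} \<and> a - b \<noteq> {} \<and> b - a \<noteq> {} \<and> \<not> V \<subseteq> a \<union> b"

lemma crosses_sym: "crosses a b \<longleftrightarrow> crosses b a"
  by (auto simp: crosses_def)

lemma crosses_compl: "a \<subseteq> V \<Longrightarrow> b \<subseteq> V \<Longrightarrow> crosses a (V - b) \<longleftrightarrow> crosses a b"
  unfolding crosses_def by blast

lemma finite_essential_crossing:
  assumes "finite (\<delta> a)" "a \<subseteq> V"
  shows "finite {d \<in> essential. cut_order d \<le> n \<and> crosses a d}"
proof (cases "\<delta> a = {}")
  case True
  then have "\<not> crosses a d" for d using assms coboundary_eq_empty_iff by (auto simp: crosses_def)
  then show ?thesis by simp
next
  case False
  define U where "U = \<Union> (\<delta> a)"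
  have U: "finite U" "U \<subseteq> V"
    using assms edges unfolding U_def coboundary_def
    by (auto intro!: finite_Union intro: card_ge_0_finite)
  obtain o' where o': "o' \<in> V" using connected by (auto simp: graph_connected_def)
  have "\<exists>P. finite P \<and> P \<subseteq> E \<and> (\<forall>d. (o' \<in> d) \<noteq> (x \<in> d) \<longrightarrow> P \<inter> \<delta> d \<noteq> {})"
    if "x \<in> U" for x
  proof -
    have "(o', x) \<in> {(x, y). {x, y} \<in> E}\<^sup>*"
      using that U o' connected by (auto simp: graph_connected_def)
    from finite_edges_meet_separating_coboundaries[OF this order.refl] show ?thesis by metis
  qed
  then obtain P where P: "\<And>x. x \<in> U \<Longrightarrow> finite (P x) \<and> P x \<subseteq> E"
    "\<And>x d. x \<in> U \<Longrightarrow> (o' \<in> d) \<noteq> (x \<in> d) \<Longrightarrow> P x \<inter> \<delta> d \<noteq> {}" by metis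
  define T where "T = (\<Union>x\<in>U. P x)"
  have T: "finite T" "T \<subseteq> E" using U P(1) by (auto simp: T_def)
  have meets: "T \<inter> \<delta> d \<noteq> {}" if d: "d \<in> essential" "crosses a d" for d
  proof (rule ccontr)
    assume "\<not> ?thesis"
    then have same: "(o' \<in> d) = (x \<in> d)" if "x \<in> U" for x using P(2)[of x d] that unfolding T_def by blast
    define d' where "d' = (if o' \<in> d then V - d else d)"
    have d': "d' \<in> essential" using essential_compl d by (simp add: d'_def)
    have cr: "crosses a d'" using d crosses_compl assms(2) essentialD(1) by (simp add: d'_def)
    have disj: "U \<inter> d' = {}" using same U(2) by (auto simp: d'_def)
    have sub: "\<delta> (d' \<inter> a) \<subseteq> \<delta> d'" "\<delta> (d' - a) \<subseteq> \<delta> d'"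
    proof -
      have *: "{x, y} \<in> \<delta> d'" if xy: "{x, y} \<in> E" "x \<in> d'" "(x \<in> a) \<noteq> (y \<in> a) \<or> y \<notin> d'" for x y
      proof -
        have "x \<notin> U" using disj xy by blast
        then have "{x, y} \<notin> \<delta> a" by (auto simp: U_def)
        then have "(x \<in> a) = (y \<in> a)" using edge_mem_coboundary xy by blast
        then show ?thesis using xy edge_mem_coboundary[of x y d'] by blast
      qed
      show "\<delta> (d' \<inter> a) \<subseteq> \<delta> d'"
      proof
        fix e assume "e \<in> \<delta> (d' \<inter> a)"
        then show "e \<in> \<delta> d'" by (rule coboundaryE) (use * in blast)
      qed
      show "\<delta> (d' - a) \<subseteq> \<delta> d'"
      proof
        fix e assume "e \<in> \<delta> (d' - a)"
        then show "e \<in> \<delta> d'" by (rule coboundaryE) (use * in blast)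
      qed
    qed
    have V: "d' \<subseteq> V" using essentialD(1)[OF d'] .
    have "\<delta> (d' \<inter> a) \<noteq> {}" "\<delta> (d' - a) \<noteq> {}"
      using cr V coboundary_eq_empty_iff[of "d' \<inter> a"] coboundary_eq_empty_iff[of "d' - a"]
      unfolding crosses_def by blast+
    then have "\<delta> (d' \<inter> a) = \<delta> d'" "\<delta> (d' - a) = \<delta> d'"
      using essential_minimal[OF d'] sub V by (meson Diff_subset inf_le1 order_trans)+
    then have "\<delta> (sym_diff (d' \<inter> a) (d' - a)) = {}" using coboundary_sym_diff by auto
    moreover have "sym_diff (d' \<inter> a) (d' - a) = d'" by blast
    ultimately show False using essentialD(4)[OF d'] by simp
  qed
  have "{d \<in> essential. cut_order d \<le> n \<and> crosses a d} \<subseteq>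
      (\<Union>e\<in>T. {d \<in> essential. cut_order d \<le> n \<and> e \<in> \<delta> d})"
    using meets by blast
  then show ?thesis
    using T finite_essential_through_edge by (meson finite_UN_I finite_subset subsetD)
qed

lemma essential_corner_orders:
  assumes le: "m \<le> n" and m: "0 < m"
    and a: "a \<in> essential" "cut_order a = n" and b: "b \<in> essential" "cut_order b = m"
    and out: "a \<inter> b \<notin> lower_span n"
  shows "\<exists>x y. (x = a \<inter> b \<and> y = V - (a \<union> b) \<or> x = b - a \<and> y = a - b) \<and>
     x \<in> essential \<and> y \<in> essential \<and> cut_order x = n \<and> cut_order y = m"
proof -
  let ?a' = "V - a" and ?b' = "V - b"
  have aV: "a \<subseteq> V" and bV: "b \<subseteq> V" using a b essentialD(1) by auto
  have ac: "a \<in> cuts" "b \<in> cuts" "?a' \<in> cuts" "?b' \<in> cuts"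
    using a b essentialD(2) cuts_compl by auto
  have n: "0 < n" using le m by simp
  have diag: "a \<inter> b \<in> cuts" "V - (a \<union> b) \<in> cuts"
      "cut_order (a \<inter> b) + cut_order (V - (a \<union> b)) \<le> cut_order a + cut_order b"
    if "a \<in> cuts" "b \<in> cuts" for a b
    using card_coboundary_Int_Un[of a b] that by (auto simp: cuts_def coboundary_compl)
  have eq: "?a' \<inter> b = b - a" "V - (?a' \<union> b) = a - b" "?a' \<inter> ?b' = V - (a \<union> b)"
    using aV bV by blast+
  have c: "a \<inter> b \<in> cuts" "V - (a \<union> b) \<in> cuts" "b - a \<in> cuts" "a - b \<in> cuts"
    "cut_order (a \<inter> b) + cut_order (V - (a \<union> b)) \<le> n + m"
    "cut_order (b - a) + cut_order (a - b) \<le> n + m"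
    using diag[of a b] diag[of ?a' b] ac a(2) b(2) eq by (auto simp: coboundary_compl)
  have low: "k \<le> cut_order x" if "x \<in> cuts" "x \<notin> lower_span k" for x k
    using that lower_spanI not_le by blast
  have ess: "x \<in> essential \<and> y \<in> essential \<and> cut_order x = n \<and> cut_order y = m"
    if "x \<in> cuts" "y \<in> cuts" "x \<notin> lower_span n" "y \<notin> lower_span m"
       "cut_order x + cut_order y \<le> n + m" for x y
  proof -
    have "cut_order x = n" "cut_order y = m" using low[of x n] low[of y m] that by simp_all
    then show ?thesis using that m n by (auto intro: essentialI)
  qed
  show ?thesis
  proof (cases "V - (a \<union> b) \<in> lower_span m")
    case False
    then have "a \<inter> b \<in> essential \<and> V - (a \<union> b) \<in> essential \<and>
        cut_order (a \<inter> b) = n \<and> cut_order (V - (a \<union> b)) = m"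
      using out c by (intro ess)
    then show ?thesis by blast
  next
    case True
    have "b - a \<notin> lower_span n"
    proof
      assume "b - a \<in> lower_span n"
      then have "sym_diff (b - a) (V - (a \<union> b)) \<in> lower_span n"
        using lower_span_mono[OF True le] lower_span_sym_diff by blast
      moreover have "sym_diff (b - a) (V - (a \<union> b)) = V - a" using aV bV by blast
      ultimately show False
        using essentialD(5)[OF essential_compl[OF a(1)]] a(2) by (simp add: coboundary_compl)
    qed
    moreover have "a - b \<notin> lower_span m"
    proof
      assume "a - b \<in> lower_span m"
      then have "sym_diff (a - b) (V - (a \<union> b)) \<in> lower_span m"
        using True lower_span_sym_diff by blast
      moreover have "sym_diff (a - b) (V - (a \<union> b)) = V - b" using aV bV by blast
      ultimately show False
        using essentialD(5)[OF essential_compl[OF b(1)]] b(2) by (simp add: coboundary_compl)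
    qed
    ultimately have "b - a \<in> essential \<and> a - b \<in> essential \<and>
        cut_order (b - a) = n \<and> cut_order (a - b) = m"
      using c by (intro ess)
    then show ?thesis by blast
  qed
qed

text \<open>Modulo \<open>lower_span\<close> the four corners of \<open>a\<close> and \<open>b\<close> satisfy the linear relations expressing
  \<open>a\<close>, \<open>b\<close> and their complements, so they cannot all be small.\<close>

lemma essential_opposite_corners:
  assumes a: "a \<in> essential" and b: "b \<in> essential"
  obtains x y where
    "(x = a \<inter> b \<and> y = V - (a \<union> b)) \<or> (x = V - (a \<union> b) \<and> y = a \<inter> b) \<or>
     (x = a - b \<and> y = b - a) \<or> (x = b - a \<and> y = a - b)"
    "x \<in> essential" "y \<in> essential" "cut_order x = cut_order a" "cut_order y = cut_order b"
proof -
  let ?P = "\<lambda>x y. (x = a \<inter> b \<and> y = V - (a \<union> b)) \<or> (x = V - (a \<union> b) \<and> y = a \<inter> b) \<or>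
     (x = a - b \<and> y = b - a) \<or> (x = b - a \<and> y = a - b)"
  have main: "\<exists>x y. ((x = a \<inter> b \<and> y = V - (a \<union> b)) \<or> (x = V - (a \<union> b) \<and> y = a \<inter> b) \<or>
       (x = a - b \<and> y = b - a) \<or> (x = b - a \<and> y = a - b)) \<and>
       x \<in> essential \<and> y \<in> essential \<and> cut_order x = cut_order a \<and> cut_order y = cut_order b"
    if a: "a \<in> essential" and b: "b \<in> essential" and le: "cut_order b \<le> cut_order a" for a b
  proof (cases "a \<inter> b \<in> lower_span (cut_order a)")
    case False
    from essential_corner_orders[OF le essentialD(4)[OF b] a refl b refl False] show ?thesis by blast
  next
    case True
    have V: "a \<subseteq> V" "b \<subseteq> V" using a b essentialD(1) by auto
    have "a \<inter> (V - b) \<notin> lower_span (cut_order a)"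
    proof
      assume "a \<inter> (V - b) \<in> lower_span (cut_order a)"
      then have "sym_diff (a \<inter> b) (a \<inter> (V - b)) \<in> lower_span (cut_order a)"
        using True lower_span_sym_diff by blast
      moreover have "sym_diff (a \<inter> b) (a \<inter> (V - b)) = a" using V by blast
      ultimately show False using essentialD(5)[OF a] by simp
    qed
    from essential_corner_orders[OF le essentialD(4)[OF b] a refl essential_compl[OF b] _ this]
    obtain x y where xy: "x = a \<inter> (V - b) \<and> y = V - (a \<union> (V - b)) \<or> x = (V - b) - a \<and> y = a - (V - b)"
      "x \<in> essential" "y \<in> essential" "cut_order x = cut_order a" "cut_order y = cut_order b"
      by (auto simp: coboundary_compl)
    have "a \<inter> (V - b) = a - b" "V - (a \<union> (V - b)) = b - a" "(V - b) - a = V - (a \<union> b)"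
      "a - (V - b) = a \<inter> b" using V by blast+
    with xy show ?thesis by metis
  qed
  have "\<exists>x y. ?P x y \<and> x \<in> essential \<and> y \<in> essential \<and>
      cut_order x = cut_order a \<and> cut_order y = cut_order b"
  proof (cases "cut_order b \<le> cut_order a")
    case True
    from main[OF a b True] show ?thesis .
  next
    case False
    then have "cut_order a \<le> cut_order b" by simp
    from main[OF b a this] obtain x y where xy:
      "(x = b \<inter> a \<and> y = V - (b \<union> a)) \<or> (x = V - (b \<union> a) \<and> y = b \<inter> a) \<or>
       (x = b - a \<and> y = a - b) \<or> (x = a - b \<and> y = b - a)"
      "x \<in> essential" "y \<in> essential" "cut_order x = cut_order b" "cut_order y = cut_order a"
      by blast
    have "?P y x" using xy(1) unfolding Int_commute[of b a] Un_commute[of b a] by blast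
    with xy show ?thesis by blast
  qed
  then show thesis using that by blast
qed

end

context connected_graph
begin

section \<open>Nested families of essential cuts\<close>

definition crossing_number :: "nat \<Rightarrow> 'a set \<Rightarrow> nat" where
  "crossing_number M a = card {d \<in> essential. cut_order d \<le> M \<and> crosses a d}"

definition optimal :: "nat \<Rightarrow> 'a set set" where
  "optimal M = {a \<in> essential. cut_order a \<le> M \<and>
     (\<forall>b\<in>essential. cut_order b = cut_order a \<longrightarrow> crossing_number M a \<le> crossing_number M b)}"

lemma not_crosses_iff:
  assumes "a \<subseteq> V" "d \<subseteq> V"
  shows "\<not> crosses a d \<longleftrightarrow> a \<inter> d = {} \<or> a \<subseteq> d \<or> d \<subseteq> a \<or> V \<subseteq> a \<union> d"
  unfolding crosses_def by blast

lemma crosses_corner: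
  assumes V: "a \<subseteq> V" "b \<subseteq> V" "d \<subseteq> V" and ab: "crosses a b"
    and a: "\<not> crosses a d" and b: "\<not> crosses b d"
  shows "\<not> crosses (a \<inter> b) d"
proof -
  have ne: "\<not> V \<subseteq> a \<union> b" using ab by (simp add: crosses_def)
  consider "a \<inter> d = {} \<or> b \<inter> d = {}" | "a \<subseteq> d \<or> b \<subseteq> d" | "d \<subseteq> a" "d \<subseteq> b"
    | "V \<subseteq> a \<union> d" "V \<subseteq> b \<union> d" | "d \<subseteq> a" "V \<subseteq> b \<union> d" | "d \<subseteq> b" "V \<subseteq> a \<union> d"
    using a b V not_crosses_iff by metis
  then have "(a \<inter> b) \<inter> d = {} \<or> a \<inter> b \<subseteq> d \<or> d \<subseteq> a \<inter> b \<or> V \<subseteq> (a \<inter> b) \<union> d"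
    by cases (use ne in blast)+
  then show ?thesis unfolding crosses_def by blast
qed

lemma crosses_opposite_corners:
  assumes V: "a \<subseteq> V" "b \<subseteq> V" "d \<subseteq> V" and a: "\<not> crosses a d"
  shows "\<not> crosses (a \<inter> b) d \<or> \<not> crosses (V - (a \<union> b)) d"
proof -
  consider "a \<inter> d = {}" | "a \<subseteq> d" | "d \<subseteq> a" | "V \<subseteq> a \<union> d"
    using a V not_crosses_iff by metis
  then show ?thesis unfolding crosses_def by cases blast+
qed

lemma crossing_number_corners:
  assumes a: "a \<in> essential" "cut_order a \<le> M" and b: "b \<in> essential" and ab: "crosses a b"
    and xy: "(x = a \<inter> b \<and> y = V - (a \<union> b)) \<or> (x = V - (a \<union> b) \<and> y = a \<inter> b) \<or>
     (x = a - b \<and> y = b - a) \<or> (x = b - a \<and> y = a - b)"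
    and ess: "x \<in> essential" "y \<in> essential"
  shows "crossing_number M x + crossing_number M y < crossing_number M a + crossing_number M b"
proof -
  let ?X = "\<lambda>a. {d \<in> essential. cut_order d \<le> M \<and> crosses a d}"
  have V: "a \<subseteq> V" "b \<subseteq> V" using a b essentialD(1) by auto
  have fin: "finite (?X c)" if "c \<in> essential" for c
    using finite_essential_crossing essentialD that by auto
  have corners: "a - b = a \<inter> (V - b)" "b - a = (V - a) \<inter> b" "V - (a \<union> b) = (V - a) \<inter> (V - b)"
    "b - a = V - (a \<union> (V - b))" using V by blast+
  have eqs: "b - a = b \<inter> (V - a)" "a - b = V - (b \<union> (V - a))" using V by blast+
  have compl: "crosses (V - c) d \<longleftrightarrow> crosses c d" if "c \<subseteq> V" "d \<subseteq> V" for c d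
    using crosses_compl crosses_sym that by metis
  have or: "crosses a d \<or> crosses b d" if cr: "crosses x d \<or> crosses y d" and d: "d \<subseteq> V" for d
  proof (rule ccontr)
    assume n: "\<not> ?thesis"
    have cc: "\<not> crosses (a' \<inter> b') d" if "a' \<in> {a, V - a}" "b' \<in> {b, V - b}" for a' b'
    proof (rule crosses_corner)
      show "crosses a' b'" "\<not> crosses a' d" "\<not> crosses b' d"
        using that ab n compl crosses_compl V d by auto
    qed (use that V d in auto)
    have "\<not> crosses (a \<inter> b) d" "\<not> crosses (a - b) d" "\<not> crosses (b - a) d" "\<not> crosses (V - (a \<union> b)) d"
      unfolding corners(1-3) by (intro cc; simp)+
    then show False using xy cr by metis
  qed
  have "and": "crosses a d \<and> crosses b d" if cr: "crosses x d" "crosses y d" and d: "d \<subseteq> V" for d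
  proof (rule ccontr)
    assume "\<not> ?thesis"
    then have "\<not> crosses a d \<or> \<not> crosses b d" by blast
    then have "\<not> crosses (a \<inter> b) d \<or> \<not> crosses (V - (a \<union> b)) d"
      "\<not> crosses (a - b) d \<or> \<not> crosses (b - a) d"
      using crosses_opposite_corners[OF V(1) _ d, of b] crosses_opposite_corners[OF V(1) _ d, of "V - b"]
        crosses_opposite_corners[OF V(2) _ d, of a] crosses_opposite_corners[OF V(2) _ d, of "V - a"]
        V unfolding corners(1)[symmetric] corners(4)[symmetric] eqs[symmetric] Int_commute[of b a] Un_commute[of b a]
      by blast+
    then show False using xy cr by metis
  qed
  have no: "\<not> crosses x a" "\<not> crosses y a"
    using xy unfolding crosses_def by blast+
  have "?X x \<union> ?X y \<subset> ?X a \<union> ?X b"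
  proof (rule psubsetI)
    show "?X x \<union> ?X y \<subseteq> ?X a \<union> ?X b" using or essentialD(1) by blast
    have "a \<in> ?X b" using a ab crosses_sym by blast
    then show "?X x \<union> ?X y \<noteq> ?X a \<union> ?X b" using no by blast
  qed
  moreover have "?X x \<inter> ?X y \<subseteq> ?X a \<inter> ?X b" using "and" essentialD(1) by blast
  ultimately have "card (?X x \<union> ?X y) + card (?X x \<inter> ?X y) < card (?X a \<union> ?X b) + card (?X a \<inter> ?X b)"
    using fin a(1) b by (intro add_less_le_mono psubset_card_mono card_mono) auto
  then show ?thesis
    using card_Un_Int[of "?X x" "?X y"] card_Un_Int[of "?X a" "?X b"] fin a(1) b ess
    by (simp add: crossing_number_def)
qed

lemma optimal_nested:
  assumes "a \<in> optimal M" "b \<in> optimal M"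
  shows "\<not> crosses a b"
proof
  assume ab: "crosses a b"
  have ess: "a \<in> essential" "b \<in> essential" "cut_order a \<le> M"
    using assms by (auto simp: optimal_def)
  obtain x y where xy: "(x = a \<inter> b \<and> y = V - (a \<union> b)) \<or> (x = V - (a \<union> b) \<and> y = a \<inter> b) \<or>
     (x = a - b \<and> y = b - a) \<or> (x = b - a \<and> y = a - b)"
    "x \<in> essential" "y \<in> essential" "cut_order x = cut_order a" "cut_order y = cut_order b"
    using essential_opposite_corners[OF ess(1,2)] by blast
  have "crossing_number M x + crossing_number M y < crossing_number M a + crossing_number M b"
    using crossing_number_corners[OF ess(1,3,2) ab xy(1-3)] .
  moreover have "crossing_number M a \<le> crossing_number M x" "crossing_number M b \<le> crossing_number M y"
    using assms xy by (auto simp: optimal_def)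
  ultimately show False by simp
qed

lemma optimal_compl:
  assumes "a \<in> optimal M"
  shows "V - a \<in> optimal M"
proof -
  have a: "a \<in> essential" using assms by (simp add: optimal_def)
  have "crosses (V - a) d \<longleftrightarrow> crosses a d" if "d \<in> essential" for d
    using crosses_compl crosses_sym essentialD(1) a that by metis
  then have "crossing_number M (V - a) = crossing_number M a"
    unfolding crossing_number_def by (intro arg_cong[where f = card]) blast
  then show ?thesis
    using assms essential_compl a by (simp add: optimal_def coboundary_compl)
qed

lemma optimal_of_order:
  assumes "a \<in> essential" "cut_order a \<le> M"
  obtains b where "b \<in> optimal M" "cut_order b = cut_order a"
proof -
  obtain b where "b \<in> essential \<and> cut_order b = cut_order a"
      "\<And>c. c \<in> essential \<and> cut_order c = cut_order a \<Longrightarrow> crossing_number M b \<le> crossing_number M c"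
    using ex_has_least_nat[of "\<lambda>b. b \<in> essential \<and> cut_order b = cut_order a" a "crossing_number M"]
      assms by blast
  then show thesis using that[of b] assms by (auto simp: optimal_def)
qed

end

text \<open>The members of \<open>\<C>\<close> will be the supports of a topological generating set of the cycle space.\<close>

locale detected_graph = connected_graph +
  fixes \<C> :: "'a set set set"
  assumes detect: "\<lbrakk>finite F; F \<subseteq> E; \<And>s. s \<in> \<C> \<Longrightarrow> even (card (F \<inter> s))\<rbrakk> \<Longrightarrow> \<exists>b\<subseteq>V. \<delta> b = F"
    and even_coboundary: "\<lbrakk>s \<in> \<C>; finite (\<delta> b)\<rbrakk> \<Longrightarrow> even (card (\<delta> b \<inter> s))"
    and cover: "e \<in> E \<Longrightarrow> \<exists>s\<in>\<C>. e \<in> s"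
begin

text \<open>The coboundary of an essential cut is connected through the members of \<open>\<C>\<close>.\<close>

lemma essential_coboundary_connected:
  assumes b: "b \<in> essential"
    and P: "\<And>s e e'. \<lbrakk>s \<in> \<C>; e \<in> s \<inter> \<delta> b; e' \<in> s \<inter> \<delta> b; P e\<rbrakk> \<Longrightarrow> P e'"
    and e: "e \<in> \<delta> b" "P e" and e': "e' \<in> \<delta> b"
  shows "P e'"
proof -
  let ?F = "{f \<in> \<delta> b. P f}"
  have fin: "finite (\<delta> b)" using essentialD[OF b] by simp
  have "even (card (?F \<inter> s))" if s: "s \<in> \<C>" for s
  proof (cases "?F \<inter> s = {}")
    case False
    then have "?F \<inter> s = \<delta> b \<inter> s" using P[OF s] by blast
    then show ?thesis using even_coboundary[OF s fin] by simp
  qed (simp only: card.empty even_zero)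
  moreover have "finite ?F" "?F \<subseteq> E" using fin coboundary_subset by auto
  ultimately obtain c where c: "c \<subseteq> V" "\<delta> c = ?F" using detect[of ?F] by blast
  then have "\<delta> c = \<delta> b" using e by (intro essential_minimal[OF b]) auto
  then show ?thesis using c(2) e' by auto
qed

text \<open>Think of the members of \<open>M\<close>, up to complements, as the edges of a tree into which the graph
  is mapped. By the parity assumption with \<open>y = z\<close>, an edge of the graph crosses an even number of
  edges of the tree, which are thus paired off along its path. Paths of edges in the same
  \<open>s \<in> \<C>\<close> part only at branch vertices, which are at even distance, so the partner of \<open>b\<close> is
  the same along all of the coboundary of \<open>b\<close>. Hence it has the same coboundary, which is absurd.\<close>

lemma no_even_nested_family:
  assumes M: "M \<subseteq> essential" "M \<noteq> {}"
    and compl: "\<And>b. b \<in> M \<Longrightarrow> V - b \<in> M"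
    and nested: "\<And>a b. a \<in> M \<Longrightarrow> b \<in> M \<Longrightarrow> \<not> crosses a b"
    and fin: "\<And>e. e \<in> E \<Longrightarrow> finite {b \<in> M. e \<in> \<delta> b}"
    and even: "\<And>s x y z. \<lbrakk>s \<in> \<C>; x \<in> \<Union>s; y \<in> \<Union>s; z \<in> \<Union>s\<rbrakk> \<Longrightarrow>
      even (card {b \<in> M. x \<in> b \<and> y \<notin> b \<and> z \<notin> b})"
  shows False
proof -
  define idx where "idx b u = card {d \<in> M. u \<in> d \<and> d \<subseteq> b}" for b u
  have finsep: "finite {d \<in> M. x \<in> d \<and> y \<notin> d}" if "{x, y} \<in> E" for x y
  proof -
    have "{d \<in> M. x \<in> d \<and> y \<notin> d} \<subseteq> {b \<in> M. {x, y} \<in> \<delta> b}"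
      using edge_mem_coboundary[OF that] by blast
    then show ?thesis using fin[OF that] by (rule finite_subset)
  qed
  have sub: "b \<subseteq> V" if "b \<in> M" for b using M(1) essentialD(1) that by blast
  have cmp: "d \<subseteq> b \<or> b \<subseteq> d" if "d \<in> M" "b \<in> M" "u \<in> b" "u \<in> d" "v \<in> V" "v \<notin> b" "v \<notin> d" for b d u v
    using nested[OF that(1,2)] that(3-) unfolding crosses_def by blast

  have total: "odd (idx b u) = even (idx (V - b) v)"
    if b: "b \<in> M" and uv: "{u, v} \<in> E" "u \<in> b" "v \<notin> b" for b u v
  proof -
    let ?A = "{d \<in> M. u \<in> d \<and> d \<subseteq> b}" and ?B = "{d \<in> M. b \<subseteq> d \<and> v \<notin> d}"
    let ?S = "{d \<in> M. u \<in> d \<and> v \<notin> d}"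
    have V: "u \<in> V" "v \<in> V" using edge_subset uv by auto
    have un: "?A \<union> ?B = ?S" using uv cmp[OF _ b uv(2) _ V(2) uv(3)] by blast
    have finS: "finite ?S" using finsep uv(1) by simp
    have int: "?A \<inter> ?B = {b}" using b uv by auto
    have "bij_betw (\<lambda>d. V - d) ?B {d \<in> M. v \<in> d \<and> d \<subseteq> V - b}"
    proof (rule bij_betw_byWitness[where f' = "\<lambda>d. V - d"])
      show "\<forall>d\<in>?B. V - (V - d) = d" "\<forall>d\<in>{d \<in> M. v \<in> d \<and> d \<subseteq> V - b}. V - (V - d) = d"
        using sub double_diff by blast+
      show "(\<lambda>d. V - d) ` ?B \<subseteq> {d \<in> M. v \<in> d \<and> d \<subseteq> V - b}" using compl V by auto
      show "(\<lambda>d. V - d) ` {d \<in> M. v \<in> d \<and> d \<subseteq> V - b} \<subseteq> ?B" using compl V sub[OF b] by auto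
    qed
    then have "card ?B = idx (V - b) v" by (simp add: idx_def bij_betw_same_card)
    moreover have "card ?A + card ?B = card ?S + 1"
    proof -
      have "?A \<subseteq> ?S" "?B \<subseteq> ?S" using un by blast+
      then have "finite ?A" "finite ?B" using finite_subset finS by blast+
      from card_Un_Int[OF this] show ?thesis unfolding un int by simp
    qed
    moreover have "even (card ?S)"
    proof -
      obtain s where "s \<in> \<C>" "{u, v} \<in> s" using cover uv by blast
      then show ?thesis using even[of s u v v] by auto
    qed
    ultimately show ?thesis unfolding idx_def by presburger
  qed

  have side: "{d \<in> M. u \<in> d \<and> u' \<notin> d \<and> v \<notin> d} = {d \<in> M. u \<in> d \<and> u' \<notin> d \<and> d \<subseteq> b}"
    if b: "b \<in> M" and uv: "u' \<in> b" "v \<notin> b" "u \<in> b" "v \<in> V" for b u u' v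
    using cmp[OF _ b uv(3) _ uv(4,2)] uv by blast

  have const: "even (idx b u) = even (idx b u')"
    if b: "b \<in> M" and uv: "{u, v} \<in> E" "u \<in> b" "v \<notin> b" "{u', v'} \<in> E" "u' \<in> b" "v' \<notin> b"
    for b u v u' v'
  proof -
    have step: "even (idx b u) = even (idx b u')"
      if uv: "{u, v} \<in> s" "{u, v} \<in> E" "u \<in> b" "v \<notin> b" "{u', v'} \<in> s" "{u', v'} \<in> E" "u' \<in> b" "v' \<notin> b"
        and s: "s \<in> \<C>" for u v u' v' s
    proof -
      have idx: "idx b u = card {d \<in> M. u \<in> d \<and> u' \<in> d \<and> d \<subseteq> b} + card {d \<in> M. u \<in> d \<and> u' \<notin> d \<and> v \<notin> d}"
        if uv: "{u, v} \<in> E" "u \<in> b" "v \<notin> b" "u' \<in> b" for u v u'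
      proof -
        have "finite {d \<in> M. u \<in> d \<and> d \<subseteq> b}" using uv by (intro finite_subset[OF _ finsep[OF uv(1)]]) auto
        then have "idx b u = card ({d \<in> M. u \<in> d \<and> d \<subseteq> b} \<inter> {d. u' \<in> d}) + card ({d \<in> M. u \<in> d \<and> d \<subseteq> b} - {d. u' \<in> d})"
          unfolding idx_def by (rule card_Int_Diff)
        moreover have "{d \<in> M. u \<in> d \<and> d \<subseteq> b} \<inter> {d. u' \<in> d} = {d \<in> M. u \<in> d \<and> u' \<in> d \<and> d \<subseteq> b}" by blast
        moreover have "{d \<in> M. u \<in> d \<and> d \<subseteq> b} - {d. u' \<in> d} = {d \<in> M. u \<in> d \<and> u' \<notin> d \<and> v \<notin> d}"
          using side[OF b uv(4,3,2)] edge_subset[OF uv(1)] by blast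
        ultimately show ?thesis by simp
      qed
      have "even (card {d \<in> M. u \<in> d \<and> u' \<notin> d \<and> v \<notin> d})" "even (card {d \<in> M. u' \<in> d \<and> u \<notin> d \<and> v' \<notin> d})"
        using even[OF s, of u u' v] even[OF s, of u' u v'] uv by blast+
      moreover have "{d \<in> M. u \<in> d \<and> u' \<in> d \<and> d \<subseteq> b} = {d \<in> M. u' \<in> d \<and> u \<in> d \<and> d \<subseteq> b}" by blast
      ultimately show ?thesis using idx[of u v u'] idx[of u' v' u] uv by simp
    qed
    let ?P = "\<lambda>e. \<forall>x\<in>e \<inter> b. even (idx b x) = even (idx b u)"
    have "?P {u', v'}"
    proof (rule essential_coboundary_connected[where P = ?P])
      show "b \<in> essential" using b M by blast
      show "{u, v} \<in> \<delta> b" "{u', v'} \<in> \<delta> b" using uv edge_mem_coboundary by blast+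
      show "?P {u, v}" using uv by blast
      fix s e e' assume s: "s \<in> \<C>" "e \<in> s \<inter> \<delta> b" "e' \<in> s \<inter> \<delta> b" "?P e"
      then obtain x y where xy: "e = {x, y}" "{x, y} \<in> E" "x \<in> b" "y \<notin> b"
        by (meson IntD2 coboundaryE)
      from s obtain x' y' where xy': "e' = {x', y'}" "{x', y'} \<in> E" "x' \<in> b" "y' \<notin> b"
        by (meson IntD2 coboundaryE)
      have "even (idx b x) = even (idx b x')" using step[of x y s x' y'] xy xy' s by blast
      then show "?P e'" using s(4) xy xy' by blast
    qed
    then show ?thesis using uv by blast
  qed

  have contra: False if b: "b \<in> M" and uv: "{u, v} \<in> E" "u \<in> b" "v \<notin> b" and ev: "even (idx b u)" for b u v
  proof -
    let ?A = "{d \<in> M. u \<in> d \<and> d \<subset> b}"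
    have finA: "finite ?A" using uv by (intro finite_subset[OF _ finsep[OF uv(1)]]) auto
    have odd_pred: "odd (card {d \<in> M. x \<in> d \<and> d \<subset> b})" if xy: "{x, y} \<in> E" "x \<in> b" "y \<notin> b" for x y
    proof -
      have "finite {d \<in> M. x \<in> d \<and> d \<subset> b}" using xy by (intro finite_subset[OF _ finsep[OF xy(1)]]) auto
      moreover have "{d \<in> M. x \<in> d \<and> d \<subseteq> b} = insert b {d \<in> M. x \<in> d \<and> d \<subset> b}" using b xy by blast
      ultimately have "idx b x = Suc (card {d \<in> M. x \<in> d \<and> d \<subset> b})" by (simp add: idx_def)
      then show ?thesis using const[OF b uv xy] ev by simp
    qed
    have "?A \<noteq> {}" using odd_pred[OF uv] by (metis card.empty even_zero)
    from finite_has_maximal[OF finA this]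
    obtain p where p: "p \<in> ?A" "\<forall>d\<in>?A. p \<subseteq> d \<longrightarrow> p = d" ..
    let ?P = "\<lambda>e. e \<inter> b \<subseteq> p"
    have P: "?P e'" if e': "e' \<in> \<delta> b" for e'
    proof (rule essential_coboundary_connected[where P = ?P, OF _ _ _ _ e'])
      show "b \<in> essential" using b M by blast
      show "{u, v} \<in> \<delta> b" using uv edge_mem_coboundary by blast
      show "?P {u, v}" using uv p by blast
      fix s e e' assume s: "s \<in> \<C>" "e \<in> s \<inter> \<delta> b" "e' \<in> s \<inter> \<delta> b" "?P e"
      then obtain x y where xy: "e = {x, y}" "{x, y} \<in> E" "x \<in> b" "y \<notin> b" "y \<in> V"
        by (meson IntD2 coboundaryE)
      from s obtain x' y' where xy': "e' = {x', y'}" "{x', y'} \<in> E" "x' \<in> b" "y' \<notin> b"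
        by (meson IntD2 coboundaryE)
      have x: "x \<in> p" using s(4) xy by blast
      show "?P e'"
      proof (rule ccontr)
        assume "\<not> ?P e'"
        then have x': "x' \<notin> p" using xy' by blast
        have "d \<subseteq> p" if d: "d \<in> M" "x \<in> d" "d \<subset> b" for d
        proof (rule ccontr)
          assume *: "\<not> d \<subseteq> p"
          have "p \<in> M" "y \<notin> p" "y \<notin> d" using p xy d by auto
          then have "p \<subseteq> d" using cmp[of d p x y] d x xy * by blast
          then have "d \<in> ?A" using p d by blast
          then show False using p(2) \<open>p \<subseteq> d\<close> * by blast
        qed
        then have "{d \<in> M. x \<in> d \<and> d \<subset> b} = {d \<in> M. x \<in> d \<and> x' \<notin> d \<and> d \<subseteq> b}"
          using x' xy' by blast
        also have "\<dots> = {d \<in> M. x \<in> d \<and> x' \<notin> d \<and> y \<notin> d}"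
          using side[OF b xy'(3) xy(4,3,5)] by simp
        finally have "even (card {d \<in> M. x \<in> d \<and> d \<subset> b})"
          using even[OF s(1), of x x' y] s xy xy' by auto
        then show False using odd_pred[OF xy(2-4)] by simp
      qed
    qed
    have "\<delta> b \<subseteq> \<delta> p"
    proof
      fix e assume e: "e \<in> \<delta> b"
      then obtain x y where xy: "e = {x, y}" "{x, y} \<in> E" "x \<in> b" "y \<notin> b" by (meson coboundaryE)
      then have "x \<in> p" "y \<notin> p" using P[OF e] p(1) by blast+
      then show "e \<in> \<delta> p" using xy edge_mem_coboundary by blast
    qed
    moreover have "\<delta> b \<noteq> {}" using uv edge_mem_coboundary by blast
    ultimately have "\<delta> b = \<delta> p"
      using essential_minimal[of p b] p(1) M(1) sub[OF b] by blast
    then have "b = p \<or> b = V - p" using coboundary_eqD[of b p] sub[OF b] sub[of p] p(1) by simp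
    then show False using p(1) by auto
  qed

  obtain b where b: "b \<in> M" using M(2) by blast
  then have "b \<in> essential" using M(1) by blast
  then obtain e where e: "e \<in> \<delta> b" using essentialD(4) by fastforce
  then obtain u v where uv: "{u, v} \<in> E" "u \<in> b" "v \<notin> b" "v \<in> V" by (meson coboundaryE)
  show False
  proof (cases "even (idx b u)")
    case True
    then show ?thesis using contra[OF b uv(1-3)] by simp
  next
    case False
    then have "even (idx (V - b) v)" using total[OF b uv(1-3)] by simp
    then show ?thesis using contra[OF compl[OF b], of v u] uv by (simp add: insert_commute)
  qed
qed

end

section \<open>The group action on essential cuts\<close>

locale connected_G_graph = G_graph + connected_graph
begin

lemma group_G: "group G"
  using group_hom by (rule group_hom.axioms(1))

lemma inv_closed: "g \<in> carrier G \<Longrightarrow> inv g \<in> carrier G"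
  by (rule group.inv_closed[OF group_G])

lemma image_inv_image:
  assumes "g \<in> carrier G" "b \<subseteq> V"
  shows "\<phi> (inv g) ` \<phi> g ` b = b"
proof -
  have "\<phi> (inv g) (\<phi> g x) = x" if "x \<in> b" for x
    using orbit_sym_aux[OF assms(1) _ refl] that assms(2) by blast
  then have "(\<lambda>x. \<phi> (inv g) (\<phi> g x)) ` b = (\<lambda>x. x) ` b" by (rule image_cong[OF refl])
  then show ?thesis by (simp add: image_image)
qed

lemma image_image_inv: "g \<in> carrier G \<Longrightarrow> b \<subseteq> V \<Longrightarrow> \<phi> g ` \<phi> (inv g) ` b = b"
  using image_inv_image[of "inv g" b] inv_closed[of g] group.inv_inv[OF group_G, of g] by simp

lemma image_V_subset: "g \<in> carrier G \<Longrightarrow> b \<subseteq> V \<Longrightarrow> \<phi> g ` b \<subseteq> V"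
  using surj_prop by blast

lemma inj_on_image_V: "g \<in> carrier G \<Longrightarrow> inj_on ((`) (\<phi> g)) (Pow V)"
  using inj_prop by (simp add: inj_on_image_Pow)

lemma image_edge:
  assumes "g \<in> carrier G" "e \<in> E"
  shows "\<phi> g ` e \<in> E"
proof -
  obtain u v where "e = {u, v}" "u \<in> V" "v \<in> V" using assms(2) by (rule edgeE)
  then show ?thesis using edge_image_iff[OF assms(1)] assms(2) by simp
qed

lemma coboundary_image:
  assumes g: "g \<in> carrier G" and b: "b \<subseteq> V"
  shows "\<delta> (\<phi> g ` b) = (`) (\<phi> g) ` \<delta> b"
proof (rule coboundary_eqI)
  show "(`) (\<phi> g) ` \<delta> b \<subseteq> E" using image_edge[OF g] coboundary_subset by blast
  fix u v assume uv: "{u, v} \<in> E"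
  then have "u \<in> \<phi> g ` V" "v \<in> \<phi> g ` V" using edge_subset surj_prop[OF g] by auto
  then obtain u' v' where uv': "u = \<phi> g u'" "v = \<phi> g v'" "u' \<in> V" "v' \<in> V" by blast
  have E: "{u', v'} \<in> E" using automorphism[OF g uv'(3,4)] uv uv' by simp
  have "{u, v} \<in> (`) (\<phi> g) ` \<delta> b \<longleftrightarrow> \<phi> g ` {u', v'} \<in> (`) (\<phi> g) ` \<delta> b" using uv' by simp
  also have "\<dots> \<longleftrightarrow> {u', v'} \<in> \<delta> b"
    using inj_on_image_mem_iff[OF inj_on_image_V[OF g], of "{u', v'}" "\<delta> b"] uv' edges coboundary_subset
    by blast
  also have "\<dots> \<longleftrightarrow> (u' \<in> b) \<noteq> (v' \<in> b)" using edge_mem_coboundary[OF E] .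
  also have "\<dots> \<longleftrightarrow> (u \<in> \<phi> g ` b) \<noteq> (v \<in> \<phi> g ` b)"
    using inj_on_image_mem_iff[OF inj_prop[OF g] _ b] uv' by simp
  finally show "{u, v} \<in> (`) (\<phi> g) ` \<delta> b \<longleftrightarrow> (u \<in> \<phi> g ` b) \<noteq> (v \<in> \<phi> g ` b)" .
qed

lemma cut_order_image:
  assumes "g \<in> carrier G" "b \<subseteq> V"
  shows "cut_order (\<phi> g ` b) = cut_order b"
proof -
  have "\<delta> b \<subseteq> Pow V" using coboundary_subset edges by blast
  then show ?thesis
    unfolding coboundary_image[OF assms] by (intro card_image inj_on_subset[OF inj_on_image_V[OF assms(1)]])
qed

lemma cuts_image: "g \<in> carrier G \<Longrightarrow> b \<in> cuts \<Longrightarrow> \<phi> g ` b \<in> cuts"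
  using image_V_subset by (auto simp: cuts_def coboundary_image)

lemma image_sym_diff:
  assumes "g \<in> carrier G" "a \<subseteq> V" "b \<subseteq> V"
  shows "\<phi> g ` sym_diff a b = sym_diff (\<phi> g ` a) (\<phi> g ` b)"
proof -
  have "\<phi> g ` (c - d) = \<phi> g ` c - \<phi> g ` d" if "c \<subseteq> V" "d \<subseteq> V" for c d
    using that inj_on_image_set_diff[OF inj_prop[OF assms(1)], of c d] by blast
  then show ?thesis using assms by (simp add: image_Un)
qed

lemma lower_span_subset: "b \<in> lower_span n \<Longrightarrow> b \<subseteq> V"
  by (induction rule: lower_span.induct) (auto simp: cuts_def)

lemma lower_span_image:
  assumes g: "g \<in> carrier G" and "b \<in> lower_span n"
  shows "\<phi> g ` b \<in> lower_span n"
  using assms(2)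
proof (induction rule: lower_span.induct)
  case (add b c)
  have V: "b \<subseteq> V" using add.hyps(1) by (simp add: cuts_def)
  have "sym_diff (\<phi> g ` b) (\<phi> g ` c) \<in> lower_span n"
    using add.IH add.hyps(2) cuts_image[OF g add.hyps(1)] cut_order_image[OF g V]
    by (intro lower_span.add) simp_all
  then show ?case using image_sym_diff[OF g V lower_span_subset[OF add.hyps(3)]] by simp
qed (simp add: lower_span.empty)

lemma essential_image:
  assumes g: "g \<in> carrier G" and a: "a \<in> essential"
  shows "\<phi> g ` a \<in> essential"
proof (rule essentialI)
  note a' = essentialD[OF a]
  show "\<phi> g ` a \<in> cuts" using cuts_image g a' by blast
  show "0 < cut_order (\<phi> g ` a)" using cut_order_image[OF g a'(1)] a' by simp
  show "\<phi> g ` a \<notin> lower_span (cut_order (\<phi> g ` a))"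
    using lower_span_image[OF inv_closed[OF g], of "\<phi> g ` a"] cut_order_image[OF g a'(1)]
      image_inv_image[OF g a'(1)] a'(5) by auto
qed

lemma crosses_image:
  assumes g: "g \<in> carrier G" and V: "a \<subseteq> V" "b \<subseteq> V" and ab: "crosses a b"
  shows "crosses (\<phi> g ` a) (\<phi> g ` b)"
proof -
  note inj = inj_prop[OF g]
  have "\<phi> g ` a - \<phi> g ` b = \<phi> g ` (a - b)" "\<phi> g ` b - \<phi> g ` a = \<phi> g ` (b - a)"
    "\<phi> g ` a \<inter> \<phi> g ` b = \<phi> g ` (a \<inter> b)"
    using inj_on_image_set_diff[OF inj, of a b, symmetric] inj_on_image_set_diff[OF inj, of b a, symmetric]
      inj_on_image_Int[OF inj V, symmetric] V by blast+
  moreover have "\<not> V \<subseteq> \<phi> g ` a \<union> \<phi> g ` b"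
  proof
    assume "V \<subseteq> \<phi> g ` a \<union> \<phi> g ` b"
    then have "\<phi> g ` V \<subseteq> \<phi> g ` (a \<union> b)" using surj_prop[OF g] by (simp add: image_Un)
    then have "V \<subseteq> a \<union> b" using inj_on_image_mem_iff[OF inj, of _ "a \<union> b"] V by blast
    then show False using ab by (simp add: crosses_def)
  qed
  ultimately show ?thesis using ab by (simp add: crosses_def)
qed

lemma crossing_number_image_le:
  assumes g: "g \<in> carrier G" and a: "a \<in> essential"
  shows "crossing_number M a \<le> crossing_number M (\<phi> g ` a)"
  unfolding crossing_number_def
proof (rule card_inj_on_le)
  let ?X = "\<lambda>a. {d \<in> essential. cut_order d \<le> M \<and> crosses a d}"
  show "inj_on ((`) (\<phi> g)) (?X a)"
    using inj_on_image_V[OF g] essentialD(1) by (auto intro: inj_on_subset)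
  show "(`) (\<phi> g) ` ?X a \<subseteq> ?X (\<phi> g ` a)"
    using essential_image[OF g] crosses_image[OF g] cut_order_image[OF g] essentialD(1) a by auto
  show "finite (?X (\<phi> g ` a))"
    using finite_essential_crossing essentialD[OF essential_image[OF g a]] by blast
qed

lemma optimal_image:
  assumes g: "g \<in> carrier G" and a: "a \<in> optimal M"
  shows "\<phi> g ` a \<in> optimal M"
proof -
  have ess: "a \<in> essential" using a by (simp add: optimal_def)
  have "crossing_number M (\<phi> g ` a) \<le> crossing_number M a"
    using crossing_number_image_le[OF inv_closed[OF g] essential_image[OF g ess]]
      image_inv_image[OF g essentialD(1)[OF ess]] by simp
  then show ?thesis
    using a essential_image[OF g ess] cut_order_image[OF g essentialD(1)[OF ess]]
    by (force simp: optimal_def)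
qed

lemma finite_essential_separating:
  assumes "x \<in> V" "y \<in> V"
  shows "finite {b \<in> essential. cut_order b \<le> n \<and> x \<in> b \<and> y \<notin> b}"
proof -
  have "(x, y) \<in> {(x, y). {x, y} \<in> E}\<^sup>*" using connected assms by (auto simp: graph_connected_def)
  from finite_edges_meet_separating_coboundaries[OF this order.refl]
  obtain P where P: "finite P" "P \<subseteq> E" "\<And>d. (x \<in> d) \<noteq> (y \<in> d) \<Longrightarrow> P \<inter> \<delta> d \<noteq> {}" by metis
  have "{b \<in> essential. cut_order b \<le> n \<and> x \<in> b \<and> y \<notin> b} \<subseteq>
      (\<Union>e\<in>P. {b \<in> essential. cut_order b \<le> n \<and> e \<in> \<delta> b})"
    using P(3) by blast
  then show ?thesis
    using P finite_essential_through_edge by (meson finite_UN_I finite_subset subsetD)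
qed

end

lemma even_card_sym_diff:
  assumes "finite A" "finite B"
  shows "even (card (sym_diff A B)) \<longleftrightarrow> (even (card A) \<longleftrightarrow> even (card B))"
proof -
  have "card (sym_diff A B) = card (A - B) + card (B - A)"
    using assms by (intro card_Un_disjoint) auto
  moreover have "card A = card (A \<inter> B) + card (A - B)" "card B = card (A \<inter> B) + card (B - A)"
    using card_Int_Diff[OF assms(1), of B] card_Int_Diff[OF assms(2), of A] by (simp_all add: Int_commute)
  ultimately show ?thesis by simp blast
qed

locale detected_G_graph = connected_G_graph + detected_graph +
  fixes \<R> :: "'c set set set"
  assumes finite_reps: "finite \<R>" "s \<in> \<R> \<Longrightarrow> finite s \<and> s \<subseteq> E"
    and reps: "s \<in> \<C> \<Longrightarrow> \<exists>g\<in>carrier G. \<exists>r\<in>\<R>. s = (`) (\<phi> g) ` r"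
begin

lemma finite_orders: "finite (cut_order ` essential)"
proof (rule ccontr)
  define X where "X = \<Union> (\<Union> \<R>)"
  have X: "finite X" "X \<subseteq> V"
  proof -
    have "finite e" if "e \<in> E" for e using edges[OF that] by (auto intro: card_ge_0_finite)
    then show "finite X" using finite_reps unfolding X_def by (auto intro!: finite_Union)
    show "X \<subseteq> V" using finite_reps(2) edges unfolding X_def by blast
  qed
  define T where "T = X \<times> X \<times> X"
  have finT: "finite T" using X by (simp add: T_def)
  assume "infinite (cut_order ` essential)"
  then obtain L where L: "L \<subseteq> cut_order ` essential" "finite L" "card L = Suc (card T)"
    using infinite_arbitrarily_large by metis
  define M where "M = Max L"
  let ?N = "\<lambda>\<Lambda> x y z. {b \<in> optimal M. cut_order b \<in> \<Lambda> \<and> x \<in> b \<and> y \<notin> b \<and> z \<notin> b}"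
  have finN: "finite (?N \<Lambda> x y z)" if "x \<in> V" "y \<in> V" for \<Lambda> x y z
    using finite_essential_separating[OF that, of M]
    by (rule finite_subset[rotated]) (auto simp: optimal_def)
  define h where "h \<Lambda> = {(x, y, z) \<in> T. odd (card (?N \<Lambda> x y z))}" for \<Lambda>
  have "\<not> inj_on h (Pow L)"
  proof
    assume "inj_on h (Pow L)"
    moreover have "h ` Pow L \<subseteq> Pow T" by (auto simp: h_def)
    ultimately have "card (Pow L) \<le> card (Pow T)" using finT by (intro card_inj_on_le) auto
    then show False using finT L by (simp add: card_Pow)
  qed
  then obtain \<Lambda>1 \<Lambda>2 where \<Lambda>: "\<Lambda>1 \<subseteq> L" "\<Lambda>2 \<subseteq> L" "\<Lambda>1 \<noteq> \<Lambda>2" "h \<Lambda>1 = h \<Lambda>2"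
    unfolding inj_on_def by blast
  define \<Lambda> where "\<Lambda> = sym_diff \<Lambda>1 \<Lambda>2"
  define B where "B = {b \<in> optimal M. cut_order b \<in> \<Lambda>}"
  have B_ess: "B \<subseteq> essential" by (auto simp: B_def optimal_def)
  have B_le: "cut_order b \<le> M" if "b \<in> B" for b using that by (auto simp: B_def optimal_def)
  have evT: "even (card {b \<in> B. x \<in> b \<and> y \<notin> b \<and> z \<notin> b})" if xyz: "x \<in> X" "y \<in> X" "z \<in> X" for x y z
  proof -
    let ?S1 = "?N \<Lambda>1 x y z" and ?S2 = "?N \<Lambda>2 x y z"
    have fin: "finite ?S1" "finite ?S2" using finN xyz X(2) by blast+
    have "(x, y, z) \<in> h \<Lambda>1 \<longleftrightarrow> (x, y, z) \<in> h \<Lambda>2" using \<Lambda>(4) by simp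
    then have par: "odd (card ?S1) = odd (card ?S2)" using xyz by (simp add: h_def T_def)
    have "{b \<in> B. x \<in> b \<and> y \<notin> b \<and> z \<notin> b} = sym_diff ?S1 ?S2"
      by (auto simp: B_def \<Lambda>_def)
    then show ?thesis using even_card_sym_diff[OF fin] par by simp
  qed
  have B_image: "\<phi> g ` b \<in> B" if "g \<in> carrier G" "b \<in> B" for g b
    using that optimal_image[OF that(1), of b M] cut_order_image[OF that(1), of b] B_ess essentialD(1)
    by (auto simp: B_def)
  show False
  proof (rule no_even_nested_family[of B])
    show "B \<subseteq> essential" by (rule B_ess)
    show "B \<noteq> {}"
    proof -
      obtain n where n: "n \<in> \<Lambda>" "n \<in> L" using \<Lambda>(1-3) unfolding \<Lambda>_def by blast
      then obtain a where a: "a \<in> essential" "cut_order a = n" using L by blast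
      then have "cut_order a \<le> M" using n L by (simp add: M_def)
      from optimal_of_order[OF a(1) this] obtain b where "b \<in> optimal M" "cut_order b = cut_order a" .
      then have "b \<in> B" using a n by (simp add: B_def)
      then show ?thesis by blast
    qed
    show "V - b \<in> B" if "b \<in> B" for b using that optimal_compl by (auto simp: B_def coboundary_compl)
    show "\<not> crosses a b" if "a \<in> B" "b \<in> B" for a b
      using that optimal_nested by (auto simp: B_def)
    show "finite {b \<in> B. e \<in> \<delta> b}" if "e \<in> E" for e
      using finite_essential_through_edge[OF that, of M]
      by (rule finite_subset[rotated]) (use B_ess B_le in auto)
    fix s x y z assume s: "s \<in> \<C>" and xyz: "x \<in> \<Union> s" "y \<in> \<Union> s" "z \<in> \<Union> s"
    obtain g r where g: "g \<in> carrier G" "r \<in> \<R>" "s = (`) (\<phi> g) ` r" using reps[OF s] by blast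
    have "\<Union> s \<subseteq> \<phi> g ` X" using g(2,3) by (auto simp: X_def)
    then obtain x' y' z' where xyz': "x = \<phi> g x'" "y = \<phi> g y'" "z = \<phi> g z'" "x' \<in> X" "y' \<in> X" "z' \<in> X"
      using xyz by blast
    have mem: "\<phi> g w \<in> \<phi> g ` b \<longleftrightarrow> w \<in> b" if "w \<in> X" "b \<in> B" for w b
      using inj_on_image_mem_iff[OF inj_prop[OF g(1)], of w b] that X(2) B_ess essentialD(1) by blast
    have "bij_betw ((`) (\<phi> g)) {b \<in> B. x' \<in> b \<and> y' \<notin> b \<and> z' \<notin> b} {b \<in> B. x \<in> b \<and> y \<notin> b \<and> z \<notin> b}"
    proof (rule bij_betwI')
      fix a b assume "a \<in> {b \<in> B. x' \<in> b \<and> y' \<notin> b \<and> z' \<notin> b}" "b \<in> {b \<in> B. x' \<in> b \<and> y' \<notin> b \<and> z' \<notin> b}"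
      then show "\<phi> g ` a = \<phi> g ` b \<longleftrightarrow> a = b"
        using inj_on_eq_iff[OF inj_on_image_V[OF g(1)], of a b] B_ess essentialD(1) by blast
    next
      fix b assume "b \<in> {b \<in> B. x' \<in> b \<and> y' \<notin> b \<and> z' \<notin> b}"
      then show "\<phi> g ` b \<in> {b \<in> B. x \<in> b \<and> y \<notin> b \<and> z \<notin> b}"
        using B_image[OF g(1)] mem xyz' by simp
    next
      fix b assume b: "b \<in> {b \<in> B. x \<in> b \<and> y \<notin> b \<and> z \<notin> b}"
      let ?b = "\<phi> (inv g) ` b"
      have B: "?b \<in> B" using B_image[OF inv_closed[OF g(1)]] b by blast
      have eq: "b = \<phi> g ` ?b" using image_image_inv[OF g(1), of b] b B_ess essentialD(1) by blast
      have "w \<in> ?b \<longleftrightarrow> \<phi> g w \<in> b" if "w \<in> X" for w using mem[OF that B] eq by simp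
      then show "\<exists>a\<in>{b \<in> B. x' \<in> b \<and> y' \<notin> b \<and> z' \<notin> b}. b = \<phi> g ` a"
        using b B eq xyz' by (intro bexI[of _ ?b]) auto
    qed
    from bij_betw_same_card[OF this] evT[OF xyz'(4-6)]
    show "even (card {b \<in> B. x \<in> b \<and> y \<notin> b \<and> z \<notin> b})" by simp
  qed
qed

lemma Bool_ring_G_finitely_generated:
  "G_finitely_generated G (add_monoid (Bool_ring V E)) (vertex_set_action \<phi>)"
proof -
  let ?A = "add_monoid (Bool_ring V E)"
  have carrier: "carrier ?A = cuts" by (simp add: Bool_ring_def cuts_def)
  have mult: "x \<otimes>\<^bsub>?A\<^esub> y = sym_diff x y" for x y by (simp add: Bool_ring_def)
  have one: "\<one>\<^bsub>?A\<^esub> = {}" by (simp add: Bool_ring_def)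
  obtain n where n: "\<And>a. a \<in> essential \<Longrightarrow> cut_order a \<le> n"
    using finite_orders by (meson finite_nat_set_iff_bounded_le image_eqI)
  define R where "R = (\<Union>e\<in>\<Union> \<R>. {a \<in> essential. cut_order a \<le> n \<and> e \<in> \<delta> a})"
  have R_cuts: "insert V R \<subseteq> cuts" using essentialD(2) by (auto simp: R_def) (simp add: cuts_def)
  have finR: "finite R"
    unfolding R_def using finite_reps finite_essential_through_edge by blast
  interpret ring: cring "Bool_ring V E" by (rule Bool_ring_cring)
  have gen: "cuts \<subseteq> M" if M: "G_submodule G ?A (vertex_set_action \<phi>) M" "insert V R \<subseteq> M" for M
  proof
    have sub: "subgroup M ?A" and act: "\<And>g x. g \<in> carrier G \<Longrightarrow> x \<in> M \<Longrightarrow> \<phi> g ` x \<in> M"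
      using M(1) by (auto simp: G_submodule_def vertex_set_action_def)
    have M_sym: "sym_diff x y \<in> M" if "x \<in> M" "y \<in> M" for x y
      using subgroup.m_closed[OF sub that] mult by simp
    have M_empty: "{} \<in> M" using subgroup.one_closed[OF sub] one by simp
    have ess: "a \<in> M" if a: "a \<in> essential" for a
    proof -
      have V: "a \<subseteq> V" using essentialD(1)[OF a] .
      obtain e where e: "e \<in> \<delta> a" using essentialD(4)[OF a] by fastforce
      then obtain s where "s \<in> \<C>" "e \<in> s" using cover coboundary_subset by blast
      then obtain g r e' where g: "g \<in> carrier G" "r \<in> \<R>" "e' \<in> r" "e = \<phi> g ` e'"
        using reps by blast
      have e': "e' \<subseteq> V" using finite_reps(2)[OF g(2)] g(3) edges by blast
      let ?a = "\<phi> (inv g) ` a"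
      have a': "?a \<in> essential" using essential_image[OF inv_closed[OF g(1)] a] .
      have "\<phi> (inv g) ` e \<in> \<delta> ?a" using coboundary_image[OF inv_closed[OF g(1)] V] e by blast
      then have "e' \<in> \<delta> ?a" using image_inv_image[OF g(1) e'] g(4) by simp
      then have "?a \<in> R" using a' n[OF a'] g unfolding R_def by blast
      then have "\<phi> g ` ?a \<in> M" using act[OF g(1)] M(2) by blast
      then show ?thesis using image_image_inv[OF g(1) V] by simp
    qed
    fix b assume "b \<in> cuts"
    then show "b \<in> M"
    proof (induction "cut_order b" arbitrary: b rule: less_induct)
      case less
      have span: "c \<in> M" if "c \<in> lower_span (cut_order b)" for c
        using that
      proof (induction rule: lower_span.induct)
        case empty
        show ?case by (rule M_empty)
      next
        case (add d c)
        then show ?case using less.hyps[OF add.hyps(2,1)] M_sym by blast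
      qed
      show ?case
      proof (cases "\<delta> b = {}")
        case True
        then have "b = {} \<or> b = V" using less.prems coboundary_eq_empty_iff by (simp add: cuts_def)
        then show ?thesis using M_empty M(2) by blast
      next
        case False
        then show ?thesis using less.prems ess span by (auto simp: essential_def)
      qed
    qed
  qed
  have whole: "G_submodule G ?A (vertex_set_action \<phi>) cuts"
    using group.subgroup_self[OF ring.add.group_axioms] vertex_set_action_closed carrier
    by (auto simp: G_submodule_def)
  have "G_submodule_generated G ?A (vertex_set_action \<phi>) (insert V R) = cuts"
    unfolding G_submodule_generated_def using gen whole R_cuts by blast
  then show ?thesis
    unfolding G_finitely_generated_def carrier using finR R_cuts by blast
qed

end

section \<open>The cycle space\<close>

definition edge_support :: "'v set set \<Rightarrow> ('v set \<Rightarrow> int) \<Rightarrow> 'v set set" where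
  "edge_support E x = {e \<in> E. x e = 1}"

definition even_on :: "'v set set \<Rightarrow> 'v set set \<Rightarrow> ('v set \<Rightarrow> int) set" where
  "even_on E F = {x \<in> carrier (edge_space E). even (\<Sum>e\<in>F. x e)}"

lemma carrier_edge_space: "carrier (edge_space E) = (\<Pi>\<^sub>E e\<in>E. {0, 1})"
proof -
  have "{0..<2::int} = {0, 1}" by auto
  then show ?thesis by (simp add: edge_space_def carrier_integer_mod_group)
qed

lemma edge_space_value:
  assumes "x \<in> carrier (edge_space E)" "e \<in> E"
  shows "x e = of_bool (e \<in> edge_support E x)"
  using PiE_mem[OF assms(1)[unfolded carrier_edge_space] assms(2)] assms(2)
  by (auto simp: edge_support_def)

lemma group_edge_space: "group (edge_space E)"
  by (simp add: edge_space_def)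

lemma edge_space_mult:
  assumes "e \<in> E"
  shows "(x \<otimes>\<^bsub>edge_space E\<^esub> y) e = (x e + y e) mod 2"
  using assms by (simp add: edge_space_def)

lemma edge_space_inv:
  assumes "x \<in> carrier (edge_space E)"
  shows "inv\<^bsub>edge_space E\<^esub> x = x"
proof (rule group.inv_equality[OF group_edge_space])
  show "x \<otimes>\<^bsub>edge_space E\<^esub> x = \<one>\<^bsub>edge_space E\<^esub>" by (auto simp: edge_space_def)
qed (use assms in auto)

lemma even_on_iff:
  assumes "x \<in> carrier (edge_space E)" "F \<subseteq> E" "finite F"
  shows "x \<in> even_on E F \<longleftrightarrow> even (card (F \<inter> edge_support E x))"
proof -
  have "(\<Sum>e\<in>F. x e) = (\<Sum>e\<in>F. of_bool (e \<in> edge_support E x))"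
    using edge_space_value[OF assms(1)] assms(2) by (intro sum.cong) auto
  also have "\<dots> = int (card (F \<inter> edge_support E x))" using assms(3) by simp
  finally show ?thesis using assms(1) by (simp add: even_on_def)
qed

lemma subgroup_even_on:
  assumes "F \<subseteq> E"
  shows "subgroup (even_on E F) (edge_space E)"
proof (rule group.subgroupI[OF group_edge_space])
  interpret group "edge_space E" by (rule group_edge_space)
  show "even_on E F \<subseteq> carrier (edge_space E)" by (auto simp: even_on_def)
  have "(\<Sum>e\<in>F. \<one>\<^bsub>edge_space E\<^esub> e) = 0"
    using assms by (intro sum.neutral) (auto simp: edge_space_def)
  then have "\<one>\<^bsub>edge_space E\<^esub> \<in> even_on E F" by (simp add: even_on_def)
  then show "even_on E F \<noteq> {}" by blast
  show "inv\<^bsub>edge_space E\<^esub> x \<in> even_on E F" if "x \<in> even_on E F" for x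
    using that edge_space_inv[of x E] by (simp add: even_on_def)
  fix x y assume xy: "x \<in> even_on E F" "y \<in> even_on E F"
  have "(\<Sum>e\<in>F. (x \<otimes>\<^bsub>edge_space E\<^esub> y) e) = (\<Sum>e\<in>F. (x e + y e) mod 2)"
    using edge_space_mult[OF subsetD[OF assms]] by (intro sum.cong refl)
  moreover have "even (\<Sum>e\<in>F. (x e + y e) mod 2) \<longleftrightarrow> even (\<Sum>e\<in>F. x e + y e)"
    by (simp add: even_iff_mod_2_eq_zero mod_sum_eq)
  ultimately show "x \<otimes>\<^bsub>edge_space E\<^esub> y \<in> even_on E F"
    using xy by (simp add: even_on_def sum.distrib)
qed

lemma closure_of_even_on:
  assumes "finite F" "F \<subseteq> E"
  shows "edge_space_topology E closure_of even_on E F \<subseteq> even_on E F"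
proof
  fix x assume x: "x \<in> edge_space_topology E closure_of even_on E F"
  have car: "x \<in> carrier (edge_space E)"
    using x by (simp add: in_closure_of topspace_edge_space)
  let ?T = "\<Pi>\<^sub>E e\<in>E. if e \<in> F then {x e} else {0, 1}"
  have "{0..<2::int} = {0, 1}" by auto
  then have top: "edge_space_topology E = product_topology (\<lambda>_. discrete_topology {0, 1}) E"
    by (simp add: edge_space_topology_def carrier_integer_mod_group)
  have xT: "x \<in> ?T" using car unfolding carrier_edge_space by auto
  have "openin (edge_space_topology E) ?T"
    unfolding top openin_PiE_gen
  proof (intro disjI2 conjI ballI)
    show "finite {e \<in> E. (if e \<in> F then {x e} else {0, 1}) \<noteq> topspace (discrete_topology {0, 1::int})}"
      using assms(1) by (rule finite_subset[rotated]) auto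
    show "openin (discrete_topology {0, 1}) (if e \<in> F then {x e} else {0, 1})" if "e \<in> E" for e
      using PiE_mem[OF car[unfolded carrier_edge_space] that] by auto
  qed
  with x xT obtain y where y: "y \<in> even_on E F" "y \<in> ?T" unfolding in_closure_of by blast
  have "y e = x e" if "e \<in> F" for e
    using PiE_mem[OF y(2), of e] that assms(2) by auto
  then have "(\<Sum>e\<in>F. y e) = (\<Sum>e\<in>F. x e)" by (intro sum.cong) auto
  then show "x \<in> even_on E F" using y(1) car by (simp add: even_on_def)
qed

lemma edge_support_indicator: "C \<subseteq> E \<Longrightarrow> edge_support E (edge_indicator E C) = C"
  by (auto simp: edge_support_def edge_indicator_def)

lemma simple_cycles_subset: "C \<in> simple_cycles E \<Longrightarrow> C \<subseteq> E \<and> finite C"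
  by (auto simp: simple_cycles_def closed_walk_edges_eq_image)

lemma cycle_space_subset: "cycle_space E \<subseteq> carrier (edge_space E)"
  unfolding cycle_space_def
  by (intro group.generate_incl[OF group_edge_space]) (use edge_indicator_closed in auto)

lemma cycle_space_subset_even_on:
  assumes "finite F" "F \<subseteq> E" "\<And>C. C \<in> simple_cycles E \<Longrightarrow> even (card (F \<inter> C))"
  shows "cycle_space E \<subseteq> even_on E F"
  unfolding cycle_space_def
proof (rule group.generate_subgroup_incl[OF group_edge_space _ subgroup_even_on[OF assms(2)]])
  show "edge_indicator E ` simple_cycles E \<subseteq> even_on E F"
  proof clarify
    fix C assume C: "C \<in> simple_cycles E"
    show "edge_indicator E C \<in> even_on E F"
      using even_on_iff[OF edge_indicator_closed assms(2,1), of C] assms(3)[OF C]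
        edge_support_indicator[of C E] simple_cycles_subset[OF C] by simp
  qed
qed

lemma finite_edge_support:
  assumes "x \<in> cycle_space E"
  shows "finite (edge_support E x)"
proof -
  let ?H = "{x \<in> carrier (edge_space E). finite (edge_support E x)}"
  have "subgroup ?H (edge_space E)"
  proof (rule group.subgroupI[OF group_edge_space])
    interpret group "edge_space E" by (rule group_edge_space)
    have "edge_support E \<one>\<^bsub>edge_space E\<^esub> = {}"
      by (auto simp: edge_support_def edge_space_def)
    then have "\<one>\<^bsub>edge_space E\<^esub> \<in> ?H" by simp
    then show "?H \<noteq> {}" by blast
    show "inv\<^bsub>edge_space E\<^esub> x \<in> ?H" if "x \<in> ?H" for x
      using that edge_space_inv[of x E] by simp
    fix x y assume xy: "x \<in> ?H" "y \<in> ?H"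
    have "edge_support E (x \<otimes>\<^bsub>edge_space E\<^esub> y) \<subseteq> edge_support E x \<union> edge_support E y"
    proof
      fix e assume "e \<in> edge_support E (x \<otimes>\<^bsub>edge_space E\<^esub> y)"
      then have e: "e \<in> E" "(x e + y e) mod 2 = 1"
        using edge_space_mult[of e E x y] by (auto simp: edge_support_def)
      then show "e \<in> edge_support E x \<union> edge_support E y"
        using edge_space_value[of x E e] edge_space_value[of y E e] xy by auto
    qed
    then have "finite (edge_support E (x \<otimes>\<^bsub>edge_space E\<^esub> y))"
      using xy finite_subset by blast
    then show "x \<otimes>\<^bsub>edge_space E\<^esub> y \<in> ?H" using xy by simp
  qed auto
  moreover have "edge_indicator E ` simple_cycles E \<subseteq> ?H"
  proof clarify
    fix C assume "C \<in> simple_cycles E"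
    then show "edge_indicator E C \<in> carrier (edge_space E) \<and> finite (edge_support E (edge_indicator E C))"
      using simple_cycles_subset[of C E] edge_support_indicator[of C E] edge_indicator_closed by simp
  qed
  ultimately have "cycle_space E \<subseteq> ?H"
    unfolding cycle_space_def by (intro group.generate_subgroup_incl[OF group_edge_space])
  then show ?thesis using assms by blast
qed

lemma (in G_graph) edge_support_action:
  assumes g: "g \<in> carrier G"
  shows "edge_support E (edge_space_action G E \<phi> g x) = (`) (\<phi> g) ` edge_support E x"
proof -
  have G: "group G" using group_hom by (rule group_hom.axioms(1))
  have inv: "inv g \<in> carrier G" "inv (inv g) = g"
    using group.inv_closed[OF G g] group.inv_inv[OF G g] by auto
  have edge: "\<phi> h ` e \<in> E \<and> \<phi> (inv h) ` \<phi> h ` e = e" if h: "h \<in> carrier G" and e: "e \<in> E" for h e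
  proof -
    obtain u v where uv: "e = {u, v}" "u \<in> V" "v \<in> V" using e by (rule edgeE)
    then show ?thesis using edge_image_iff[OF h] e orbit_sym_aux[OF h _ refl] by simp
  qed
  have edge_inv: "\<phi> (inv g) ` e \<in> E" "\<phi> g ` \<phi> (inv g) ` e = e" if "e \<in> E" for e
    using edge[OF inv(1) that] inv(2) by auto
  have "edge_support E (edge_space_action G E \<phi> g x) = {e \<in> E. x (\<phi> (inv g) ` e) = 1}"
    by (auto simp: edge_support_def edge_space_action_def)
  also have "\<dots> = (`) (\<phi> g) ` edge_support E x"
  proof (intro equalityI subsetI)
    fix e assume e: "e \<in> {e \<in> E. x (\<phi> (inv g) ` e) = 1}"
    then have "\<phi> (inv g) ` e \<in> edge_support E x" using edge_inv by (simp add: edge_support_def)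
    then show "e \<in> (`) (\<phi> g) ` edge_support E x" using edge_inv(2)[of e] e by (intro image_eqI[of _ _ "\<phi> (inv g) ` e"]) auto
  next
    fix e assume "e \<in> (`) (\<phi> g) ` edge_support E x"
    then show "e \<in> {e \<in> E. x (\<phi> (inv g) ` e) = 1}" using edge[OF g] by (auto simp: edge_support_def)
  qed
  finally show ?thesis .
qed

lemma (in simple_graph) coboundary_if_even_on_generating_set:
  assumes conn: "graph_connected V E" and S: "topological_generating_set E S"
    and F: "finite F" "F \<subseteq> E" "\<And>x. x \<in> S \<Longrightarrow> even (card (F \<inter> edge_support E x))"
  shows "\<exists>b\<subseteq>V. coboundary E b = F"
proof -
  have car: "S \<subseteq> carrier (edge_space E)"
    using S cycle_space_subset by (auto simp: topological_generating_set_def)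
  then have "S \<subseteq> even_on E F" using F by (auto simp: even_on_iff)
  then have "generate (edge_space E) S \<subseteq> even_on E F"
    by (intro group.generate_subgroup_incl[OF group_edge_space] subgroup_even_on F(2))
  then have "cycle_space E \<subseteq> even_on E F"
    using S closure_of_mono closure_of_even_on[OF F(1,2)]
    unfolding topological_generating_set_def by (meson order_trans)
  moreover have "edge_indicator E C \<in> cycle_space E" if "C \<in> simple_cycles E" for C
    unfolding cycle_space_def using that by (intro generate.incl) blast
  ultimately have "even (card (F \<inter> C))" if "C \<in> simple_cycles E" for C
    using that F(1,2) even_on_iff[OF edge_indicator_closed, of F E C]
      edge_support_indicator[of C E] simple_cycles_subset[OF that]
    by auto
  from coboundary_if_even_on_simple_cycles[OF conn F(2) this] show ?thesis by metis
qed

theorem theoremA5: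
  fixes G :: "('g, 'm) monoid_scheme"
    and V :: "'v set" and E :: "'v set set"
    and \<phi> :: "'g \<Rightarrow> 'v \<Rightarrow> 'v"
  assumes "G_graph G V E \<phi>"
    and "graph_connected V E"
    and "two_edge_connected V E"
    and "topologically_G_finitely_generated G E \<phi>"
  shows "G_finitely_generated G (add_monoid (Bool_ring V E)) (vertex_set_action \<phi>)"
proof -
  interpret G_graph G V E \<phi> by (rule assms(1))
  let ?act = "edge_space_action G E \<phi>"
  obtain S where S: "topological_generating_set E S" "finite (orbits G S ?act)"
    using assms(4) by (auto simp: topologically_G_finitely_generated_def)
  have S_sub: "S \<subseteq> cycle_space E" using S(1) by (simp add: topological_generating_set_def)
  have one: "\<one>\<^bsub>G\<^esub> \<in> carrier G"
    using group_hom by (intro monoid.one_closed group.is_monoid group_hom.axioms(1))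
  define rep where "rep o' = (SOME x. x \<in> S \<and> o' = orbit G ?act x)" for o'
  have rep: "rep o' \<in> S" "o' = orbit G ?act (rep o')" if "o' \<in> orbits G S ?act" for o'
  proof -
    have "\<exists>x. x \<in> S \<and> o' = orbit G ?act x" using that by (auto simp: orbits_def)
    from someI_ex[OF this] show "rep o' \<in> S" "o' = orbit G ?act (rep o')" by (auto simp: rep_def)
  qed
  define \<C> where "\<C> = edge_support E ` S"
  define \<R> where "\<R> = edge_support E ` rep ` orbits G S ?act"
  have detect: "\<exists>b\<subseteq>V. coboundary E b = F"
    if "finite F" "F \<subseteq> E" "\<And>s. s \<in> \<C> \<Longrightarrow> even (card (F \<inter> s))" for F
    using that by (intro coboundary_if_even_on_generating_set[OF assms(2) S(1)]) (auto simp: \<C>_def)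
  interpret detected_G_graph G V E \<phi> \<C> \<R>
  proof unfold_locales
    show "graph_connected V E" by (rule assms(2))
    show "\<exists>b\<subseteq>V. coboundary E b = F"
      if "finite F" "F \<subseteq> E" "\<And>s. s \<in> \<C> \<Longrightarrow> even (card (F \<inter> s))" for F
      using detect that by blast
    show "even (card (coboundary E b \<inter> s))" if s: "s \<in> \<C>" and fin: "finite (coboundary E b)" for s b
    proof -
      obtain x where x: "x \<in> S" "s = edge_support E x" using s by (auto simp: \<C>_def)
      then have "x \<in> cycle_space E" using S_sub by blast
      then have "x \<in> even_on E (coboundary E b)" "x \<in> carrier (edge_space E)"
        using cycle_space_subset_even_on[OF fin coboundary_subset even_card_coboundary_simple_cycle]
          cycle_space_subset by blast+
      then show ?thesis using even_on_iff[OF _ coboundary_subset fin] x by simp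
    qed
    show "\<exists>s\<in>\<C>. e \<in> s" if e: "e \<in> E" for e
    proof (rule ccontr)
      assume "\<not> ?thesis"
      then have "{e} \<inter> s = {}" if "s \<in> \<C>" for s using that by blast
      then obtain b where b: "b \<subseteq> V" "coboundary E b = {e}" using detect[of "{e}"] e by auto
      have "graph_connected V (E - {e})" using assms(3) e by (simp add: two_edge_connected_def)
      then have "b = {} \<or> b = V" using coboundary_empty_connected[of "E - {e}" b] b by auto
      then show False using b(2) by auto
    qed
    show "finite \<R>" using S(2) by (simp add: \<R>_def)
    show "finite s \<and> s \<subseteq> E" if "s \<in> \<R>" for s
      using that rep(1) S_sub finite_edge_support by (auto simp: \<R>_def edge_support_def)
    show "\<exists>g\<in>carrier G. \<exists>r\<in>\<R>. s = (`) (\<phi> g) ` r" if s: "s \<in> \<C>" for s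
    proof -
      obtain x where x: "x \<in> S" "s = edge_support E x" using s by (auto simp: \<C>_def)
      let ?o = "orbit G ?act x"
      have orb: "?o \<in> orbits G S ?act" using x by (auto simp: orbits_def)
      have "?act \<one>\<^bsub>G\<^esub> x \<in> ?o" using one by (auto simp: orbit_def)
      then obtain g where g: "g \<in> carrier G" "?act \<one>\<^bsub>G\<^esub> x = ?act g (rep ?o)"
        using rep(2)[OF orb] by (auto simp: orbit_def)
      have "(`) (\<phi> \<one>\<^bsub>G\<^esub>) ` s = s"
      proof -
        have "\<phi> \<one>\<^bsub>G\<^esub> ` e = e" if "e \<in> E" for e
        proof -
          have "\<phi> \<one>\<^bsub>G\<^esub> v = v" if "v \<in> e" for v
            using that edges[OF \<open>e \<in> E\<close>] id_eq_one[symmetric] by auto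
          then show ?thesis by simp
        qed
        moreover have "s \<subseteq> E" using x by (auto simp: edge_support_def)
        ultimately have "(\<lambda>e. \<phi> \<one>\<^bsub>G\<^esub> ` e) ` s = (\<lambda>e. e) ` s" by (intro image_cong) auto
        then show ?thesis by simp
      qed
      then have "s = (`) (\<phi> g) ` edge_support E (rep ?o)"
        using edge_support_action[OF one, of x] edge_support_action[OF g(1), of "rep ?o"] g(2) x by simp
      moreover have "edge_support E (rep ?o) \<in> \<R>" using orb by (simp add: \<R>_def)
      ultimately show ?thesis using g(1) by blast
    qed
  qed
  show ?thesis by (rule Bool_ring_G_finitely_generated)
qed

end
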